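(* Let $f$ be a Rademacher random multiplicative function, let $\delta>0$ and let $\theta\in(0,1)$ be fixed. Then there exists $\sigma_0\in(1/2,1]$ such that for all $1/2<\sigma\leq\sigma_0$, with $x\geq 1$ defined by $$\log x=\frac{1}{(\sigma-1/2)^{1/\theta}},$$ the probability that the partial sums $\sum_{n\leq y}\frac{f(n)}{n^\sigma}$ are positive for all $y>x$ is at least $$1-\exp\left(-\frac{1}{2\theta}\frac{(\log x)^{2-2\theta}}{(\log\log x)^{1+2\delta}}\right).$$
   Context: A Rademacher random multiplicative function is defined as follows: $(f(p))_p$, indexed by the primes $p$, is a sequence of independent random variables each taking the values $+1$ and $-1$ with probability $1/2$, and for positive integers $n$, $f(n)=\mu^2(n)\prod_{p\mid n}f(p)$, where $\mu$ is the Möbius function (so $f(n)=0$ if $n$ is not squarefree, and $f(1)=1$). *)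

theory Defs
  imports "HOL-Probability.Probability" "HOL-Computational_Algebra.Computational_Algebra"
begin

definition moebius_mu :: "nat \<Rightarrow> real" where
  "moebius_mu n = (if squarefree n then (-1) ^ card (prime_factors n) else 0)"

(* The value f 0 is left unspecified: only positive arguments are meaningful. *)
locale rademacher_random_multiplicative = prob_space M for M :: "'a measure" +
  fixes f :: "nat \<Rightarrow> 'a \<Rightarrow> real"
  assumes indep_primes: "indep_vars (\<lambda>_. borel) f {p. prime p}"
    and prob_plus_one: "\<And>p. prime p \<Longrightarrow> prob {\<omega> \<in> space M. f p \<omega> = 1} = 1 / 2"
    and prob_minus_one: "\<And>p. prime p \<Longrightarrow> prob {\<omega> \<in> space M. f p \<omega> = -1} = 1 / 2"
    and multiplicative_extension:
      "\<And>n \<omega>. n > 0 \<Longrightarrow> \<omega> \<in> space M \<Longrightarrow>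
        f n \<omega> = (moebius_mu n)\<^sup>2 * (\<Prod>p\<in>prime_factors n. f p \<omega>)"

definition partial_sum :: "(nat \<Rightarrow> real) \<Rightarrow> real \<Rightarrow> real \<Rightarrow> real" where
  "partial_sum a \<sigma> y = (\<Sum>n | 1 \<le> n \<and> real n \<le> y. a n / real n powr \<sigma>)"

end

theory Submission
  imports Defs "HOL-Real_Asymp.Real_Asymp"
begin

text \<open>
  Write \<open>\<sigma> = 1/2 + \<epsilon>\<close> and let \<open>F\<close> be the Euler product over the primes up to a large bound, so that
  the partial sum up to \<open>y\<close> is \<open>F\<close> minus the tail over smooth \<open>n > y\<close>. It suffices that
  \<open>F > exp (-R)\<close> while all tails beyond \<open>x\<close> are at most \<open>exp (-R)\<close>, where \<open>R = \<epsilon> ln x / 8\<close>. Both events are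
  controlled by moments of order \<open>2k\<close> with \<open>k\<close> of order \<open>\<epsilon> ln x / ln (1/\<epsilon>)\<close>, which hypercontractivity for
  Walsh series reduces to sums of \<open>(2k-1)\<^sup>\<omega>\<^sup>(\<^sup>n\<^sup>) n\<^sup>-\<^sup>2\<^sup>\<sigma>\<close>: for \<open>F\<close> one uses that \<open>1/F\<close> is essentially
  the product with all signs reversed, and for the tails a dyadic decomposition of \<open>(y, \<infinity>)\<close>, as in the
  Rademacher-Menshov inequality. The failure probability is then at most
  \<open>2 exp (-c (\<epsilon> ln x)\<^sup>2 / ln (1/\<epsilon>))\<close>, that is, the exponent is of order \<open>(ln x) powr (2-2\<theta>) / ln (ln x)\<close>,
  and the factor \<open>(ln (ln x)) powr (2\<delta>)\<close> in the claim absorbs all constants.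
\<close>

section \<open>Hypercontractivity for Walsh series\<close>

text \<open>A sign pattern is encoded by the set \<open>S\<close> of coordinates whose sign is \<open>+1\<close>.\<close>
definition walsh :: "'a set \<Rightarrow> 'a set \<Rightarrow> real" where
  "walsh S T = (\<Prod>p\<in>T. if p \<in> S then 1 else -1)"

lemma sum_Pow_insert:
  fixes g :: "'a set \<Rightarrow> 'b::comm_monoid_add"
  assumes "finite A" "p \<notin> A"
  shows "(\<Sum>S\<in>Pow (insert p A). g S) = (\<Sum>S\<in>Pow A. g S) + (\<Sum>S\<in>Pow A. g (insert p S))"
proof -
  have "inj_on (insert p) (Pow A)"
    using assms(2) by (intro inj_onI) (metis PowD insert_ident subsetD)
  moreover have "Pow A \<inter> insert p ` Pow A = {}"
    using assms(2) by auto
  ultimately show ?thesis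
    using assms(1) by (simp add: Pow_insert sum.union_disjoint sum.reindex)
qed

lemma walsh_insert_left:
  assumes "p \<notin> T"
  shows "walsh (insert p S) T = walsh S T"
  unfolding walsh_def using assms by (intro prod.cong) auto

lemma walsh_insert_right:
  assumes "finite T" "p \<notin> T"
  shows "walsh S (insert p T) = (if p \<in> S then 1 else -1) * walsh S T"
  using assms by (simp add: walsh_def)

section \<open>Scalar inequalities for the induction step of hypercontractivity\<close>

lemma weighted_am_gm_power:
  fixes a b :: real
  assumes "0 \<le> a" "0 \<le> b" "j \<le> k"
  shows "real k * (a ^ (k - j) * b ^ j) \<le> real (k - j) * a ^ k + real j * b ^ k"
proof -
  consider "k = 0" | "j = 0" | "j = k" | "0 < j" "j < k" "a = 0 \<or> b = 0"
    | "0 < j" "j < k" "0 < a" "0 < b"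
    using assms by linarith
  then show ?thesis
  proof cases
    case 4
    then show ?thesis using assms by (auto simp: zero_power)
  next
    case 5
    have "(a ^ k) powr (real (k - j) / k) * (b ^ k) powr (real j / k)
        \<le> real (k - j) / k * a ^ k + real j / k * b ^ k"
      using 5 by (intro Youngs_inequality_0) (auto simp: of_nat_diff field_simps)
    moreover have "(a ^ k) powr (real (k - j) / k) = a ^ (k - j)"
      using 5 by (simp add: powr_powr flip: powr_realpow del: of_nat_diff)
    moreover have "(b ^ k) powr (real j / k) = b ^ j"
      using 5 by (simp add: powr_powr flip: powr_realpow)
    ultimately show ?thesis
      using 5 by (simp add: field_simps del: of_nat_diff)
  qed auto
qed

text \<open>Hoelder's inequality with exponents \<open>k / (k - j)\<close> and \<open>k / j\<close>:
  normalise by \<open>\<alpha>\<close> and \<open>\<beta>\<close>, then sum the weighted AM-GM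
  inequality. The weight \<open>w\<close> will be the number of sign patterns, since sums over
  patterns are not averaged.\<close>

lemma holder_sum_power:
  fixes a b :: "'a \<Rightarrow> real"
  assumes "finite I" "\<And>i. i \<in> I \<Longrightarrow> 0 \<le> a i" "\<And>i. i \<in> I \<Longrightarrow> 0 \<le> b i"
    and "0 \<le> \<alpha>" "0 \<le> \<beta>" "0 \<le> w" "j \<le> k" "0 < k"
    and a: "(\<Sum>i\<in>I. a i ^ k) \<le> w * \<alpha> ^ k" and b: "(\<Sum>i\<in>I. b i ^ k) \<le> w * \<beta> ^ k"
  shows "(\<Sum>i\<in>I. a i ^ (k - j) * b i ^ j) \<le> w * (\<alpha> ^ (k - j) * \<beta> ^ j)"
proof -
  have zero: "c i = 0" if "(\<Sum>i\<in>I. c i ^ k) \<le> 0" "\<And>i. i \<in> I \<Longrightarrow> 0 \<le> c i" "i \<in> I"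
    for c :: "'a \<Rightarrow> real" and i
  proof -
    have "(\<Sum>i\<in>I. c i ^ k) = 0"
      using that by (intro antisym sum_nonneg) auto
    then have "c i ^ k = 0"
      using that assms(1) by (subst (asm) sum_nonneg_eq_0_iff) auto
    then show ?thesis by simp
  qed
  consider "j = 0" | "j = k" | "0 < j" "j < k" "\<alpha> = 0" | "0 < j" "j < k" "\<beta> = 0"
    | "0 < j" "j < k" "0 < \<alpha>" "0 < \<beta>"
    using assms by linarith
  then show ?thesis
  proof cases
    case 3
    then have "a i = 0" if "i \<in> I" for i
      using zero[of a i] that assms by (simp add: zero_power)
    then show ?thesis using 3 by (simp add: zero_power)
  next
    case 4
    then have "b i = 0" if "i \<in> I" for i
      using zero[of b i] that assms by (simp add: zero_power)
    then show ?thesis using 4 by (simp add: zero_power)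
  next
    case 5
    let ?c = "\<alpha> ^ (k - j) * \<beta> ^ j"
    have c: "?c > 0" using 5 by simp
    have "real k * (\<Sum>i\<in>I. a i ^ (k - j) * b i ^ j) =
        ?c * (\<Sum>i\<in>I. real k * ((a i / \<alpha>) ^ (k - j) * (b i / \<beta>) ^ j))"
      using 5 by (simp add: sum_distrib_left power_divide field_simps)
    also have "\<dots> \<le> ?c * (\<Sum>i\<in>I. real (k - j) * (a i / \<alpha>) ^ k + real j * (b i / \<beta>) ^ k)"
      using assms 5 by (intro mult_left_mono sum_mono weighted_am_gm_power) auto
    also have "\<dots> = ?c * (real (k - j) * ((\<Sum>i\<in>I. a i ^ k) / \<alpha> ^ k) + real j * ((\<Sum>i\<in>I. b i ^ k) / \<beta> ^ k))"
      by (simp add: sum.distrib power_divide flip: sum_distrib_left sum_divide_distrib del: of_nat_diff)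
    also have "\<dots> \<le> ?c * (real (k - j) * w + real j * w)"
      using 5 a b by (intro mult_left_mono add_mono) (auto simp: field_simps)
    also have "\<dots> = real k * (w * ?c)"
      using 5 by (simp add: of_nat_diff algebra_simps)
    finally show ?thesis using \<open>0 < k\<close> by simp
  qed (use assms in auto)
qed

text \<open>Induction on \<open>j\<close> by comparing ratios: from \<open>j\<close> to
  \<open>j + 1\<close> the left side gains the factor
  \<open>(k - j) (2k - 2j - 1) / ((j + 1) (2j + 1))\<close>, the right side
  \<open>(k - j) (2k - 1) / (j + 1)\<close>.\<close>

lemma choose_double_le:
  assumes "j \<le> k"
  shows "real ((2 * k) choose (2 * j)) \<le> real (k choose j) * (2 * real k - 1) ^ j"
  using assms
proof (induction j)
  case (Suc j)
  have step: "real (n choose Suc m) * (real m + 1) = real (n choose m) * (real n - real m)"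
    if "m \<le> n" for n m :: nat
  proof -
    have "Suc m * (n choose Suc m) = (n - m) * (n choose m)"
      by (simp only: binomial_absorption binomial_absorb_comp)
    then have "real (Suc m * (n choose Suc m)) = real ((n - m) * (n choose m))"
      by (rule arg_cong)
    then show ?thesis using that by (simp add: of_nat_diff algebra_simps)
  qed
  let ?a = "real ((2*k) choose (2*j))" and ?b = "real (k choose j)"
  have e1: "real ((2*k) choose (2 * Suc j)) * (2 * j + 2) * (2 * j + 1) =
      ?a * (2 * real k - 2 * real j) * (2 * real k - 2 * real j - 1)"
  proof -
    have "real ((2*k) choose (2 * Suc j)) * (2 * j + 2)
        = real ((2*k) choose Suc (2 * j)) * (2 * real k - 2 * real j - 1)"
      using step[of "Suc (2*j)" "2*k"] Suc.prems by (simp add: algebra_simps del: binomial_Suc_Suc)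
    moreover have "real ((2*k) choose Suc (2 * j)) * (2 * j + 1) = ?a * (2 * real k - 2 * real j)"
      using step[of "2*j" "2*k"] Suc.prems by (simp add: algebra_simps del: binomial_Suc_Suc)
    ultimately show ?thesis by algebra
  qed
  have e2: "real (k choose Suc j) * (real j + 1) = ?b * (real k - real j)"
    using step[of j k] Suc.prems by simp
  have "real ((2*k) choose (2 * Suc j)) * ((2 * j + 2) * (2 * j + 1)) =
     2 * (real k - real j) * (2 * real k - 2 * real j - 1) * ?a"
    using e1 by (simp add: algebra_simps)
  also have "\<dots> \<le> 2 * (real k - real j) * (2 * real k - 2 * real j - 1) * (?b * (2 * real k - 1) ^ j)"
    using Suc by (intro mult_left_mono Suc.IH) auto
  also have "\<dots> = 2 * (real (k choose Suc j) * (real j + 1)) * (2 * real k - 1) ^ j * (2 * real k - 2 * real j - 1)"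
    unfolding e2 by (simp add: algebra_simps)
  also have "\<dots> \<le> 2 * (real (k choose Suc j) * (real j + 1)) * (2 * real k - 1) ^ j * ((2 * real k - 1) * (2 * real j + 1))"
    using Suc.prems by (intro mult_left_mono mult_nonneg_nonneg) (auto simp: algebra_simps)
  also have "\<dots> = real (k choose Suc j) * (2 * real k - 1) ^ Suc j * ((2 * j + 2) * (2 * j + 1))"
    by (simp add: algebra_simps)
  finally show ?case
    by (subst (asm) mult_le_cancel_right) (auto simp del: of_nat_mult of_nat_add binomial_Suc_Suc)
qed simp

lemma power_even_plus_minus:
  fixes a b :: real
  shows "(a + b) ^ (2 * k) + (a - b) ^ (2 * k)
    = 2 * (\<Sum>j\<le>k. real ((2 * k) choose (2 * j)) * ((a\<^sup>2) ^ (k - j) * (b\<^sup>2) ^ j))"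
proof -
  let ?t = "\<lambda>i. real ((2 * k) choose i) * a ^ (2 * k - i) * b ^ i"
  have "(a + b) ^ (2 * k) + (a - b) ^ (2 * k) = (b + a) ^ (2 * k) + (-b + a) ^ (2 * k)"
    by (simp add: algebra_simps)
  also have "\<dots> = (\<Sum>i\<le>2*k. ?t i) + (\<Sum>i\<le>2*k. (-1) ^ i * ?t i)"
    unfolding binomial_ring by (simp add: power_minus[of b] algebra_simps)
  also have "\<dots> = (\<Sum>i\<le>2*k. if even i then 2 * ?t i else 0)"
    unfolding sum.distrib[symmetric] by (intro sum.cong) auto
  also have "\<dots> = (\<Sum>i\<in>(\<lambda>j. 2 * j) ` {..k}. 2 * ?t i)"
    by (rule sum.mono_neutral_cong_right) (auto elim!: evenE)
  also have "\<dots> = 2 * (\<Sum>j\<le>k. ?t (2 * j))"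
    by (subst sum.reindex) (auto simp: inj_on_def sum_distrib_left)
  also have "(\<Sum>j\<le>k. ?t (2 * j)) = (\<Sum>j\<le>k. real ((2 * k) choose (2 * j)) * ((a\<^sup>2) ^ (k - j) * (b\<^sup>2) ^ j))"
    by (intro sum.cong) (auto simp: diff_mult_distrib mult_ac simp flip: power_mult)
  finally show ?thesis .
qed

text \<open>
  Adding a coordinate replaces the sum \<open>X\<close> by \<open>X \<plusminus> Y\<close>. The odd powers of \<open>Y\<close> cancel between the two signs, and
  Hoelder's inequality with \<open>choose_double_le\<close> turns the even ones into the expansion of
  \<open>(\<alpha> + (2k-1) \<beta>) ^ k\<close>.
\<close>
theorem walsh_hypercontractive:
  fixes c :: "'a set \<Rightarrow> real"
  assumes "finite A" "0 < k"
  shows "(\<Sum>S\<in>Pow A. (\<Sum>T\<in>Pow A. c T * walsh S T) ^ (2 * k))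
    \<le> 2 ^ card A * (\<Sum>T\<in>Pow A. (c T)\<^sup>2 * (2 * real k - 1) ^ card T) ^ k"
  using assms(1)
proof (induction A arbitrary: c rule: finite_induct)
  case empty
  show ?case by (simp add: walsh_def power_mult)
next
  case (insert p A)
  let ?r = "2 * real k - 1"
  let ?c = "\<lambda>T. c (insert p T)"
  let ?X = "\<lambda>S. \<Sum>T\<in>Pow A. c T * walsh S T" and ?Y = "\<lambda>S. \<Sum>T\<in>Pow A. ?c T * walsh S T"
  let ?\<alpha> = "\<Sum>T\<in>Pow A. (c T)\<^sup>2 * ?r ^ card T" and ?\<beta> = "\<Sum>T\<in>Pow A. (?c T)\<^sup>2 * ?r ^ card T"
  have r: "?r \<ge> 0" using assms by simp
  have nn: "?\<alpha> \<ge> 0" "?\<beta> \<ge> 0" using r by (auto intro!: sum_nonneg)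
  have ft: "finite T" "p \<notin> T" if "T \<in> Pow A" for T
    using that insert finite_subset by auto
  have minus: "(\<Sum>T\<in>Pow (insert p A). c T * walsh S T) = ?X S - ?Y S" if "S \<in> Pow A" for S
  proof -
    have "p \<notin> S" using that insert by auto
    then show ?thesis using insert ft
      by (simp add: sum_Pow_insert walsh_insert_right sum_negf)
  qed
  have plus: "(\<Sum>T\<in>Pow (insert p A). c T * walsh (insert p S) T) = ?X S + ?Y S" if "S \<in> Pow A" for S
    using insert ft by (simp add: sum_Pow_insert walsh_insert_right walsh_insert_left)
  have "(\<Sum>S\<in>Pow (insert p A). (\<Sum>T\<in>Pow (insert p A). c T * walsh S T) ^ (2 * k))
     = (\<Sum>S\<in>Pow A. (?X S + ?Y S) ^ (2 * k) + (?X S - ?Y S) ^ (2 * k))"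
    unfolding sum_Pow_insert[OF insert.hyps, of "\<lambda>S. (\<Sum>T\<in>Pow (insert p A). c T * walsh S T) ^ (2 * k)"]
    by (simp add: minus plus sum.distrib)
  also have "\<dots> = 2 * (\<Sum>j\<le>k. real ((2 * k) choose (2 * j)) *
       (\<Sum>S\<in>Pow A. ((?X S)\<^sup>2) ^ (k - j) * ((?Y S)\<^sup>2) ^ j))"
    unfolding power_even_plus_minus sum_distrib_left by (rule sum.swap)
  \<comment> \<open>The induction hypothesis, for \<open>c\<close> and for the coefficients of the
    sets containing \<open>p\<close>, gives the two moment bounds that Hoelder requires, with
    \<open>w = 2 ^ card A\<close>.\<close>
  also have "\<dots> \<le> 2 * (\<Sum>j\<le>k. (real (k choose j) * ?r ^ j) * (2 ^ card A * (?\<alpha> ^ (k - j) * ?\<beta> ^ j)))"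
    using insert assms nn r
    by (intro mult_left_mono sum_mono mult_mono choose_double_le holder_sum_power)
      (auto simp flip: power_mult intro!: sum_nonneg mult_nonneg_nonneg)
  also have "\<dots> = 2 ^ card (insert p A) * (\<Sum>j\<le>k. real (k choose j) * (?r * ?\<beta>) ^ j * ?\<alpha> ^ (k - j))"
  proof -
    have "2 * (\<Sum>j\<le>k. (real (k choose j) * r ^ j) * (w * (a ^ (k - j) * b ^ j)))
        = 2 * w * (\<Sum>j\<le>k. real (k choose j) * (r * b) ^ j * a ^ (k - j))" for r w a b :: real
      by (simp add: sum_distrib_left power_mult_distrib mult_ac)
    then show ?thesis using insert by simp
  qed
  also have "(\<Sum>j\<le>k. real (k choose j) * (?r * ?\<beta>) ^ j * ?\<alpha> ^ (k - j)) = (?r * ?\<beta> + ?\<alpha>) ^ k"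
    by (simp add: binomial_ring)
  also have "?r * ?\<beta> + ?\<alpha> = (\<Sum>T\<in>Pow (insert p A). (c T)\<^sup>2 * ?r ^ card T)"
    using insert ft by (simp add: sum_Pow_insert sum_distrib_left mult_ac)
  finally show ?case .
qed

section \<open>Sums over squarefree smooth numbers\<close>

lemma sum_Pow_prod:
  fixes g :: "'a \<Rightarrow> 'b::comm_semiring_1"
  assumes "finite A"
  shows "(\<Sum>T\<in>Pow A. \<Prod>p\<in>T. g p) = (\<Prod>p\<in>A. 1 + g p)"
  using prod_add[OF assms, of g "\<lambda>_. 1"] by (simp add: add.commute)

lemma prime_factors_prod_primes:
  fixes T :: "nat set"
  assumes "finite T" "\<And>p. p \<in> T \<Longrightarrow> prime p"
  shows "prime_factors (\<Prod>T) = T"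
proof -
  have "prime_factorization (prod_mset (mset_set T)) = mset_set T"
    using assms by (intro prime_factorization_prod_mset_primes) auto
  then show ?thesis using assms by (simp add: prod_unfold_prod_mset)
qed

lemma powr_prod:
  fixes T :: "nat set"
  assumes "\<And>p. p \<in> T \<Longrightarrow> 0 < p"
  shows "real (\<Prod>T) powr s = (\<Prod>p\<in>T. real p powr s)"
  using assms by (simp add: prod_powr_distrib)

text \<open>Unique factorisation, which allows sums over sets of primes to be reindexed as sums over
  squarefree numbers.\<close>

lemma inj_on_prod_primes:
  fixes A :: "nat set"
  assumes "finite A" "\<And>p. p \<in> A \<Longrightarrow> prime p"
  shows "inj_on (\<lambda>T. \<Prod>T) (Pow A)"
proof (rule inj_onI)
  fix S T assume "S \<in> Pow A" "T \<in> Pow A" "\<Prod>S = \<Prod>T"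
  then show "S = T"
    using assms prime_factors_prod_primes[of S] prime_factors_prod_primes[of T]
    by (metis PowD finite_subset subsetD)
qed

lemma prod_primes_pos:
  fixes T :: "nat set"
  assumes "\<And>p. p \<in> T \<Longrightarrow> prime p"
  shows "0 < \<Prod>T"
  using assms by (intro prod_pos) (auto simp: prime_gt_0_nat)

text \<open>Integral comparison: the mean value theorem for \<open>t powr -\<epsilon>\<close> bounds
  each term after the first by a telescoping difference.\<close>

lemma sum_powr_le:
  assumes "0 < \<epsilon>"
  shows "(\<Sum>n=1..N. real n powr -(1 + \<epsilon>)) \<le> 1 + 1 / \<epsilon>"
proof -
  have step: "real (Suc n) powr -(1 + \<epsilon>) \<le> (real n powr -\<epsilon> - real (Suc n) powr -\<epsilon>) / \<epsilon>" if "n \<ge> 1" for n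
  proof -
    have "\<exists>z>real n. z < real (Suc n) \<and> real (Suc n) powr -\<epsilon> - real n powr -\<epsilon> =
       (real (Suc n) - real n) * (-\<epsilon> * z powr (-\<epsilon> - 1))"
      using that by (intro MVT2) (auto intro!: derivative_eq_intros)
    then obtain z where z: "real n < z" "z < real (Suc n)"
      "real (Suc n) powr -\<epsilon> - real n powr -\<epsilon> = (real (Suc n) - real n) * (-\<epsilon> * z powr (-\<epsilon> - 1))"
      by blast
    have "real (Suc n) powr (-\<epsilon> - 1) \<le> z powr (-\<epsilon> - 1)"
      using z assms by (intro powr_mono2') auto
    also have "z powr (-\<epsilon> - 1) = (real n powr -\<epsilon> - real (Suc n) powr -\<epsilon>) / \<epsilon>"
      using z(3) assms by (simp add: eq_divide_eq mult.commute)
    moreover have "-(1 + \<epsilon>) = -\<epsilon> - 1" by simp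
    ultimately show ?thesis by metis
  qed
  have "(\<Sum>n=1..Suc N. real n powr -(1 + \<epsilon>)) \<le> 1 + (1 - real (Suc N) powr -\<epsilon>) / \<epsilon>" for N
  proof (induction N)
    case (Suc N)
    show ?case using Suc step[of "Suc N"] by (simp add: diff_divide_distrib)
  qed simp
  moreover have "(1 - real (Suc N) powr -\<epsilon>) / \<epsilon> \<le> 1 / \<epsilon>" for N
    using assms by (intro divide_right_mono) auto
  ultimately show ?thesis
    using assms by (cases N) (auto intro: order_trans[OF _ add_left_mono])
qed

text \<open>The expanded product runs over distinct squarefree numbers, so it is a subsum of the
  zeta series at \<open>1 + \<epsilon>\<close>. The bound does not depend on \<open>A\<close>, which
  later permits a limit over all primes.\<close>

lemma prod_one_plus_powr_le:
  fixes A :: "nat set"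
  assumes "finite A" "\<And>p. p \<in> A \<Longrightarrow> prime p" "0 < \<epsilon>"
  shows "(\<Prod>p\<in>A. 1 + real p powr -(1 + \<epsilon>)) \<le> 1 + 1 / \<epsilon>"
proof -
  have "(\<Prod>p\<in>A. 1 + real p powr -(1 + \<epsilon>)) = (\<Sum>T\<in>Pow A. real (\<Prod>T) powr -(1 + \<epsilon>))"
    using assms by (subst sum_Pow_prod[symmetric])
      (auto intro!: sum.cong powr_prod[symmetric] prime_gt_0_nat simp del: of_nat_prod)
  also have "\<dots> = (\<Sum>n\<in>(\<lambda>T. \<Prod>T) ` Pow A. real n powr -(1 + \<epsilon>))"
    using inj_on_prod_primes[OF assms(1,2)] by (simp add: sum.reindex)
  also have "\<dots> \<le> (\<Sum>n=1..Max ((\<lambda>T. \<Prod>T) ` Pow A). real n powr -(1 + \<epsilon>))"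
  proof (rule sum_mono2)
    show "(\<lambda>T. \<Prod>T) ` Pow A \<subseteq> {1..Max ((\<lambda>T. \<Prod>T) ` Pow A)}"
    proof safe
      fix T assume "T \<subseteq> A"
      then have "0 < \<Prod>T" using assms by (intro prod_primes_pos) auto
      moreover have "\<Prod>T \<le> Max ((\<lambda>T. \<Prod>T) ` Pow A)"
        using \<open>T \<subseteq> A\<close> assms by (intro Max_ge) auto
      ultimately show "\<Prod>T \<in> {1..Max ((\<lambda>T. \<Prod>T) ` Pow A)}" by simp
    qed
  qed auto
  also have "\<dots> \<le> 1 + 1 / \<epsilon>"
    using assms by (intro sum_powr_le) auto
  finally show ?thesis .
qed

text \<open>Rankin's trick, together with \<open>1 + (2k-1) u \<le> (1 + u) ^ (2k-1)\<close> in each Euler factor.\<close>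
lemma sum_Pow_tail_le:
  fixes A :: "nat set"
  assumes "finite A" "\<And>p. p \<in> A \<Longrightarrow> prime p" "0 < \<epsilon>" "0 < m" "0 < k"
  shows "(\<Sum>T | T \<in> Pow A \<and> m \<le> real (\<Prod>T). real (\<Prod>T) powr -(1 + 2 * \<epsilon>) * (2 * real k - 1) ^ card T)
     \<le> m powr -\<epsilon> * (1 + 1 / \<epsilon>) ^ (2 * k - 1)"
proof -
  let ?r = "2 * real k - 1"
  have r: "?r \<ge> 0" using assms by simp
  have fin: "finite T" "\<And>p. p \<in> T \<Longrightarrow> 0 < p" "\<And>p. p \<in> T \<Longrightarrow> prime p" if "T \<in> Pow A" for T
    using that assms finite_subset prime_gt_0_nat by auto
  have "(\<Sum>T | T \<in> Pow A \<and> m \<le> real (\<Prod>T). real (\<Prod>T) powr -(1 + 2 * \<epsilon>) * ?r ^ card T)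
     \<le> (\<Sum>T | T \<in> Pow A \<and> m \<le> real (\<Prod>T). m powr -\<epsilon> * (real (\<Prod>T) powr -(1 + \<epsilon>) * ?r ^ card T))"
  proof (rule sum_mono)
    fix T assume "T \<in> {T. T \<in> Pow A \<and> m \<le> real (\<Prod>T)}"
    then have "real (\<Prod>T) powr -\<epsilon> \<le> m powr -\<epsilon>"
      using assms by (intro powr_mono2') auto
    then have "real (\<Prod>T) powr -\<epsilon> * (real (\<Prod>T) powr -(1 + \<epsilon>) * ?r ^ card T)
      \<le> m powr -\<epsilon> * (real (\<Prod>T) powr -(1 + \<epsilon>) * ?r ^ card T)"
      using r by (intro mult_right_mono) auto
    moreover have "real (\<Prod>T) powr -(1 + 2 * \<epsilon>) = real (\<Prod>T) powr -\<epsilon> * real (\<Prod>T) powr -(1 + \<epsilon>)"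
      unfolding powr_add[symmetric] by (rule arg_cong2[of _ _ _ _ "(powr)"]) auto
    ultimately show "real (\<Prod>T) powr -(1 + 2 * \<epsilon>) * ?r ^ card T \<le> m powr -\<epsilon> * (real (\<Prod>T) powr -(1 + \<epsilon>) * ?r ^ card T)"
      by (simp only: mult.assoc)
  qed
  also have "\<dots> \<le> (\<Sum>T\<in>Pow A. m powr -\<epsilon> * (real (\<Prod>T) powr -(1 + \<epsilon>) * ?r ^ card T))"
    using assms r by (intro sum_mono2) auto
  also have "\<dots> = m powr -\<epsilon> * (\<Sum>T\<in>Pow A. \<Prod>p\<in>T. ?r * real p powr -(1 + \<epsilon>))"
    unfolding sum_distrib_left
    by (intro sum.cong refl arg_cong2[of _ _ _ _ "(*)"]) (simp add: fin powr_prod prod.distrib mult.commute del: of_nat_prod)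
  also have "\<dots> = m powr -\<epsilon> * (\<Prod>p\<in>A. 1 + ?r * real p powr -(1 + \<epsilon>))"
    using assms by (simp add: sum_Pow_prod)
  also have "\<dots> \<le> m powr -\<epsilon> * (\<Prod>p\<in>A. (1 + real p powr -(1 + \<epsilon>)) ^ (2 * k - 1))"
  proof (intro mult_left_mono prod_mono conjI)
    fix p
    show "1 + ?r * real p powr -(1 + \<epsilon>) \<le> (1 + real p powr -(1 + \<epsilon>)) ^ (2 * k - 1)"
      using Bernoulli_inequality[of "real p powr -(1 + \<epsilon>)" "2 * k - 1"] assms
      by (simp add: of_nat_diff order.trans[OF _ powr_ge_zero])
    show "0 \<le> 1 + ?r * real p powr -(1 + \<epsilon>)"
      using r by (intro add_nonneg_nonneg mult_nonneg_nonneg) auto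
  qed auto
  also have "\<dots> \<le> m powr -\<epsilon> * (1 + 1 / \<epsilon>) ^ (2 * k - 1)"
    unfolding prod_power_distrib[symmetric]
    using assms by (intro mult_left_mono power_mono prod_one_plus_powr_le prod_nonneg) auto
  finally show ?thesis .
qed

section \<open>Dyadic chaining\<close>

text \<open>The points of the chain are \<open>\<lceil>N / 2 ^ j\<rceil> * 2 ^ j\<close>; consecutive ones differ by at most one dyadic block.\<close>
lemma dyadic_chain:
  fixes H :: "nat \<Rightarrow> real"
  assumes "1 \<le> N" "N \<le> 2 ^ J"
    and block: "\<And>i a. i < J \<Longrightarrow> 1 \<le> a \<Longrightarrow> a < 2 ^ J \<Longrightarrow> N \<le> a * 2 ^ i \<Longrightarrow> \<bar>H (a * 2 ^ i) - H ((a + 1) * 2 ^ i)\<bar> \<le> l i"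
    and l: "\<And>i. 0 \<le> l i"
  shows "\<bar>H N - H (2 ^ J)\<bar> \<le> (\<Sum>i<J. l i)"
proof -
  \<comment> \<open>Here \<open>b\<close> plays the role of the rounded-up quotient of
    \<open>N\<close> by \<open>2 ^ j\<close>. The bound \<open>b \<le> 2 ^ (J - j)\<close> forces
    \<open>b = 1\<close> at \<open>j = J\<close>, so that the chain ends at
    \<open>2 ^ J\<close>.\<close>
  have "\<exists>b\<ge>1. N \<le> b * 2 ^ j \<and> b \<le> 2 ^ (J - j) \<and> \<bar>H N - H (b * 2 ^ j)\<bar> \<le> (\<Sum>i<j. l i)" if "j \<le> J" for j
    using that
  proof (induction j)
    case 0
    then show ?case using assms by (intro exI[of _ N]) auto
  next
    case (Suc j)
    then obtain b where b: "b \<ge> 1" "N \<le> b * 2 ^ j" "b \<le> 2 ^ (J - j)" "\<bar>H N - H (b * 2 ^ j)\<bar> \<le> (\<Sum>i<j. l i)"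
      by auto
    have J: "(2::nat) ^ (J - j) = 2 * 2 ^ (J - Suc j)"
      using Suc.prems by (metis Suc_diff_le diff_Suc_Suc power_Suc)
    show ?case
    proof (cases "even b")
      case True
      then obtain c where c: "b = 2 * c" by auto
      then have "\<bar>H N - H (c * 2 ^ Suc j)\<bar> \<le> (\<Sum>i<j. l i)" using b(4) by (simp add: mult_ac)
      then have "\<bar>H N - H (c * 2 ^ Suc j)\<bar> \<le> (\<Sum>i<Suc j. l i)" using l[of j] by simp
      then show ?thesis using b c J by (intro exI[of _ c]) auto
    next
      case False
      then obtain c where c: "b = 2 * c + 1" by (elim oddE)
      \<comment> \<open>An odd \<open>b\<close> cannot equal the even number
        \<open>2 ^ (J - j)\<close>, so rounding up to \<open>b + 1\<close> stays within the
        invariant.\<close>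
      have "b < 2 ^ (J - j)" using b(3) False J by (metis dvd_triv_left le_neq_implies_less)
      moreover have "(2::nat) ^ (J - j) \<le> 2 ^ J" by simp
      ultimately have "b < 2 ^ J" by linarith
      then have "\<bar>H (b * 2 ^ j) - H ((b + 1) * 2 ^ j)\<bar> \<le> l j"
        using Suc.prems b by (intro block) auto
      moreover have "(b + 1) * 2 ^ j = (c + 1) * 2 ^ Suc j" using c by simp
      ultimately have "\<bar>H N - H ((c + 1) * 2 ^ Suc j)\<bar> \<le> (\<Sum>i<Suc j. l i)"
        using b(4) by simp
      moreover have "N \<le> (c + 1) * 2 ^ Suc j"
        using b(2) \<open>(b + 1) * 2 ^ j = (c + 1) * 2 ^ Suc j\<close> by (metis add_mult_distrib le_add1 le_trans)
      ultimately show ?thesis using \<open>b < 2 ^ (J - j)\<close> c J by (intro exI[of _ "c + 1"]) auto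
    qed
  qed
  from this[of J] show ?thesis by (auto simp: le_Suc_eq)
qed

text \<open>Superadditivity of the \<open>k\<close>-th power on nonnegative reals. It lets the block
  bounds of one dyadic level be combined into a single \<open>k\<close>-th power of their
  total.\<close>

lemma sum_power_le_power_sum:
  fixes v :: "'a \<Rightarrow> real"
  assumes "finite I" "\<And>i. i \<in> I \<Longrightarrow> 0 \<le> v i" "0 < k"
  shows "(\<Sum>i\<in>I. v i ^ k) \<le> (\<Sum>i\<in>I. v i) ^ k"
  using assms
proof (induction I rule: finite_induct)
  case (insert i I)
  have nn: "0 \<le> v i" "0 \<le> sum v I" using insert by (auto intro: sum_nonneg)
  obtain m where m: "k = Suc m" using assms(3) by (cases k) auto
  have "v i ^ k + sum v I ^ k \<le> (v i + sum v I) ^ k"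
  proof -
    have "v i * v i ^ m \<le> v i * (v i + sum v I) ^ m" "sum v I * sum v I ^ m \<le> sum v I * (v i + sum v I) ^ m"
      using nn by (auto intro!: mult_left_mono power_mono)
    then show ?thesis by (simp add: m algebra_simps)
  qed
  then show ?case using insert by simp
qed (use assms in auto)

section \<open>Counting bad sign patterns\<close>

lemma powr_half_square:
  "(x powr -(1/2 + \<epsilon>))\<^sup>2 = x powr -(1 + 2 * \<epsilon>)" for x \<epsilon> :: real
  unfolding power2_eq_square powr_add[symmetric] by (rule arg_cong2[of _ _ _ _ "(powr)"]) auto

text \<open>Markov's inequality for the moment of order \<open>2 * k\<close>, in counting form, with
  hypercontractivity bounding the moment.\<close>

lemma walsh_tail_count:
  fixes c :: "'a set \<Rightarrow> real"
  assumes "finite A" "0 < k" "0 < t"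
  shows "real (card {S \<in> Pow A. t \<le> \<bar>\<Sum>T\<in>Pow A. c T * walsh S T\<bar>})
    \<le> 2 ^ card A * ((\<Sum>T\<in>Pow A. (c T)\<^sup>2 * (2 * real k - 1) ^ card T) / t\<^sup>2) ^ k"
proof -
  let ?X = "\<lambda>S. \<Sum>T\<in>Pow A. c T * walsh S T"
  let ?E = "{S \<in> Pow A. t \<le> \<bar>?X S\<bar>}"
  have "real (card ?E) * t ^ (2 * k) = (\<Sum>S\<in>?E. t ^ (2 * k))" by simp
  also have "\<dots> \<le> (\<Sum>S\<in>?E. ?X S ^ (2 * k))"
  proof (rule sum_mono)
    fix S assume "S \<in> ?E"
    then have "t ^ (2 * k) \<le> \<bar>?X S\<bar> ^ (2 * k)" using assms by (intro power_mono) auto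
    then show "t ^ (2 * k) \<le> ?X S ^ (2 * k)" by (simp add: power_even_abs)
  qed
  also have "\<dots> \<le> (\<Sum>S\<in>Pow A. ?X S ^ (2 * k))"
    using assms by (intro sum_mono2) auto
  also have "\<dots> \<le> 2 ^ card A * (\<Sum>T\<in>Pow A. (c T)\<^sup>2 * (2 * real k - 1) ^ card T) ^ k"
    using assms by (intro walsh_hypercontractive)
  finally show ?thesis
    using assms by (simp add: power_divide field_simps flip: power_mult)
qed

text \<open>Both factors of each summand are multiplicative over \<open>T\<close>, so the sum
  factors over \<open>A\<close>. The cases \<open>\<eta> = 1\<close> and \<open>\<eta> = -1\<close>
  give the Euler product and the one with all signs reversed.\<close>

lemma walsh_euler_product:
  fixes A :: "nat set"
  assumes "finite A" "\<And>p. p \<in> A \<Longrightarrow> prime p"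
  shows "(\<Sum>T\<in>Pow A. (\<eta> ^ card T * real (\<Prod>T) powr s) * walsh S T)
    = (\<Prod>p\<in>A. 1 + \<eta> * (if p \<in> S then 1 else -1) * real p powr s)"
proof -
  have "(\<eta> ^ card T * real (\<Prod>T) powr s) * walsh S T
      = (\<Prod>p\<in>T. \<eta> * (if p \<in> S then 1 else -1) * real p powr s)" if "T \<in> Pow A" for T
    using that assms prime_gt_0_nat unfolding walsh_def prod.distrib
    by (subst powr_prod) (auto simp: mult_ac)
  then show ?thesis
    using assms by (simp add: sum_Pow_prod)
qed

text \<open>With \<open>G\<close> the product with reversed signs, \<open>F G = (\<Prod>p\<in>A. 1 - p powr -(1 + 2\<epsilon>))\<close> is bounded below, so a
  small \<open>F\<close> forces a large \<open>G\<close>, whose moments are bounded by hypercontractivity.\<close>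
lemma euler_product_small_count:
  fixes A :: "nat set"
  assumes "finite A" "\<And>p. p \<in> A \<Longrightarrow> prime p" "0 < \<epsilon>" "0 < k"
  shows "real (card {S \<in> Pow A. (\<Sum>T\<in>Pow A. real (\<Prod>T) powr -(1/2 + \<epsilon>) * walsh S T) \<le> exp (-R)})
    \<le> 2 ^ card A * (exp (-2 * R) * (1 + 1 / \<epsilon>) ^ (2 * k + 3)) ^ k"
proof -
  let ?U = "1 + 1 / \<epsilon>"
  let ?u = "\<lambda>p. real p powr -(1/2 + \<epsilon>)"
  let ?s = "\<lambda>S p. if p \<in> S then 1 else -1 :: real"
  let ?c = "\<lambda>T. (-1) ^ card T * real (\<Prod>T) powr -(1/2 + \<epsilon>)"
  let ?F = "\<lambda>S. \<Sum>T\<in>Pow A. real (\<Prod>T) powr -(1/2 + \<epsilon>) * walsh S T"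
  let ?G = "\<lambda>S. \<Sum>T\<in>Pow A. ?c T * walsh S T"
  \<comment> \<open>The size forced on \<open>?G S\<close> when \<open>?F S \<le> exp (-R)\<close>,
    given \<open>1 \<le> ?U ^ 2 * (?F S * ?G S)\<close>.\<close>
  define t where "t = 1 / (exp (-R) * ?U ^ 2)"
  have U: "?U > 0" using assms by (simp add: add_pos_pos)
  have t: "t > 0" using U by (simp add: t_def)
  have FG: "1 \<le> ?U ^ 2 * (?F S * ?G S)" for S
  proof -
    have F: "?F S = (\<Prod>p\<in>A. 1 + ?s S p * ?u p)"
      using walsh_euler_product[OF assms(1,2), of 1 "-(1/2 + \<epsilon>)" S] by simp
    have G: "?G S = (\<Prod>p\<in>A. 1 - ?s S p * ?u p)"
      using walsh_euler_product[OF assms(1,2), of "-1" "-(1/2 + \<epsilon>)" S] by simp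
    \<comment> \<open>With \<open>w = p powr -(1 + 2\<epsilon>) \<le> 1/2\<close> this is
      \<open>(1 + w)^2 (1 - w) = 1 + w (1 - w - w^2) \<ge> 1\<close>. It turns the lower bound for
      the product of \<open>1 - w\<close> into an upper bound for the product of
      \<open>1 + w\<close>.\<close>
    have le: "1 \<le> (1 + real p powr -(1 + 2 * \<epsilon>)) ^ 2 * ((1 + ?s S p * ?u p) * (1 - ?s S p * ?u p))"
      if "p \<in> A" for p
    proof -
      let ?w = "real p powr -(1 + 2 * \<epsilon>)"
      have p: "real p \<ge> 2" using assms that prime_ge_2_nat by fastforce
      have "?w \<le> real p powr -1" using p assms by (intro powr_mono) auto
      also have "\<dots> \<le> 1 / 2" using p by (simp add: powr_minus_divide)
      finally have w: "?w \<le> 1 / 2" .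
      have "(1 + ?s S p * ?u p) * (1 - ?s S p * ?u p) = 1 - ?u p * ?u p"
        by (simp add: algebra_simps)
      also have "?u p * ?u p = ?w"
        using powr_half_square[of "real p" \<epsilon>] by (simp only: power2_eq_square)
      finally have *: "(1 + ?s S p * ?u p) * (1 - ?s S p * ?u p) = 1 - ?w" .
      have "?w * ?w \<le> ?w * (1/2)" using w by (intro mult_left_mono) auto
      then have "0 \<le> ?w * (1 - ?w - ?w * ?w)" using w by (intro mult_nonneg_nonneg) auto
      then have "1 \<le> (1 + ?w) ^ 2 * (1 - ?w)" by (simp add: algebra_simps power2_eq_square)
      then show ?thesis unfolding * .
    qed
    have "1 \<le> (\<Prod>p\<in>A. (1 + real p powr -(1 + 2 * \<epsilon>)) ^ 2 * ((1 + ?s S p * ?u p) * (1 - ?s S p * ?u p)))"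
      using le by (intro prod_ge_1)
    also have "\<dots> = (\<Prod>p\<in>A. 1 + real p powr -(1 + 2 * \<epsilon>)) ^ 2 * (?F S * ?G S)"
      unfolding F G prod.distrib prod_power_distrib ..
    finally have 1: "1 \<le> (\<Prod>p\<in>A. 1 + real p powr -(1 + 2 * \<epsilon>)) ^ 2 * (?F S * ?G S)" .
    \<comment> \<open>The sign of \<open>?F S * ?G S\<close> is needed before its coefficient may be
      enlarged to \<open>?U ^ 2\<close>.\<close>
    have "0 \<le> b" if "1 \<le> a ^ 2 * b" for a b :: real
      using that mult_nonneg_nonpos[of "a ^ 2" b] by (cases "b \<le> 0") auto
    from this[OF 1] have "0 \<le> ?F S * ?G S" .
    moreover have "(\<Prod>p\<in>A. 1 + real p powr -(1 + 2 * \<epsilon>)) \<le> ?U"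
    proof -
      have "(\<Prod>p\<in>A. 1 + real p powr -(1 + 2 * \<epsilon>)) \<le> 1 + 1 / (2 * \<epsilon>)"
        using assms by (intro prod_one_plus_powr_le) auto
      also have "\<dots> \<le> ?U" using assms by (simp add: field_simps)
      finally show ?thesis .
    qed
    moreover have "0 \<le> (\<Prod>p\<in>A. 1 + real p powr -(1 + 2 * \<epsilon>))"
      by (intro prod_nonneg) (auto intro: add_nonneg_nonneg)
    ultimately have "(\<Prod>p\<in>A. 1 + real p powr -(1 + 2 * \<epsilon>)) ^ 2 * (?F S * ?G S) \<le> ?U ^ 2 * (?F S * ?G S)"
      by (intro mult_right_mono power_mono) auto
    with 1 show ?thesis by linarith
  qed
  have sub: "{S \<in> Pow A. ?F S \<le> exp (-R)} \<subseteq> {S \<in> Pow A. t \<le> \<bar>?G S\<bar>}"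
  proof safe
    fix S assume S: "?F S \<le> exp (-R)"
    have Fpos: "?F S > 0"
    proof -
      have "?F S = (\<Prod>p\<in>A. 1 + ?s S p * ?u p)"
        using walsh_euler_product[OF assms(1,2), of 1 "-(1/2 + \<epsilon>)" S] by simp
      moreover have "0 < 1 + ?s S p * ?u p" if "p \<in> A" for p
      proof -
        have "real p > 1" using assms that prime_gt_1_nat by fastforce
        then have "?u p < 1" using assms powr_less_cancel_iff[of "real p" "-(1/2 + \<epsilon>)" 0] by auto
        then show ?thesis by (auto intro: add_pos_nonneg)
      qed
      ultimately show ?thesis by (simp add: prod_pos)
    qed
    have "1 / (e * u ^ 2) \<le> g" if "1 \<le> u ^ 2 * (f * g)" "0 < f" "f \<le> e" "0 < u" for u f g e :: real
    proof -
      have "0 < g" using that mult_nonneg_nonpos[of "u ^ 2 * f" g] by (cases "g \<le> 0") (auto simp: mult.assoc)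
      then have "u ^ 2 * (f * g) \<le> u ^ 2 * (e * g)"
        using that by (intro mult_left_mono mult_right_mono) auto
      then have "1 \<le> g * (e * u ^ 2)" using that by (simp add: mult_ac)
      then show ?thesis using that by (simp add: pos_divide_le_eq)
    qed
    from this[OF FG Fpos S U] have "t \<le> ?G S"
      unfolding t_def .
    then show "t \<le> \<bar>?G S\<bar>" by linarith
  qed
  have V: "(\<Sum>T\<in>Pow A. (?c T)\<^sup>2 * (2 * real k - 1) ^ card T) \<le> ?U ^ (2 * k - 1)"
  proof -
    have "(?c T)\<^sup>2 = real (\<Prod>T) powr -(1 + 2 * \<epsilon>)" if "T \<in> Pow A" for T
      unfolding power_mult_distrib powr_half_square by (simp flip: power_mult)
    moreover have "{T. T \<in> Pow A \<and> 1 \<le> real (\<Prod>T)} = Pow A"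
    proof -
      have "0 < \<Prod>T" if "T \<subseteq> A" for T using that assms by (intro prod_primes_pos) auto
      then show ?thesis by (force simp: Suc_le_eq simp del: of_nat_prod)
    qed
    ultimately show ?thesis
      using sum_Pow_tail_le[OF assms(1,2,3) _ assms(4), of 1] by simp
  qed
  have "real (card {S \<in> Pow A. ?F S \<le> exp (-R)}) \<le> real (card {S \<in> Pow A. t \<le> \<bar>?G S\<bar>})"
    using sub assms by (intro of_nat_mono card_mono) auto
  also have "\<dots> \<le> 2 ^ card A * ((\<Sum>T\<in>Pow A. (?c T)\<^sup>2 * (2 * real k - 1) ^ card T) / t\<^sup>2) ^ k"
    using assms t by (intro walsh_tail_count)
  also have "\<dots> \<le> 2 ^ card A * (?U ^ (2 * k - 1) / t\<^sup>2) ^ k"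
    using V t assms by (intro mult_left_mono power_mono divide_right_mono divide_nonneg_nonneg sum_nonneg) auto
  also have "?U ^ (2 * k - 1) / t\<^sup>2 = exp (-2 * R) * ?U ^ (2 * k + 3)"
  proof -
    have "?U ^ (2 * k + 3) = ?U ^ (2 * k - 1) * ?U ^ 4"
      using assms by (simp flip: power_add)
    then show ?thesis unfolding t_def using U
      by (simp add: power_divide exp_minus divide_simps flip: power_mult exp_double)
  qed
  finally show ?thesis .
qed

text \<open>A union bound over levels \<open>i\<close> and blocks
  \<open>[a 2^i, (a + 1) 2^i)\<close>: if every block sum stays below its level's threshold,
  chaining from \<open>N\<close> to a point beyond all products bounds \<open>H S N\<close>. Within
  a level the block variances add up to one Rankin tail, so the number of blocks costs
  nothing.\<close>

lemma tail_count:
  fixes A :: "nat set"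
  assumes A: "finite A" "\<And>p. p \<in> A \<Longrightarrow> prime p" and "0 < \<epsilon>" "0 < k" "1 \<le> x"
  defines "U \<equiv> 1 + 16 / \<epsilon>"
  defines "H \<equiv> (\<lambda>S N. \<Sum>T | T \<in> Pow A \<and> N \<le> \<Prod>T. real (\<Prod>T) powr -(1/2 + \<epsilon>) * walsh S T)"
  shows "real (card {S \<in> Pow A. \<exists>N. x < real N \<and> exp (-R) < \<bar>H S N\<bar>})
    \<le> 2 ^ card A * ((exp (2 * R) * x powr -(\<epsilon> / 2) * U ^ (2 * k + 1)) ^ k * U)"
proof -
  \<comment> \<open>The largest product that occurs, so \<open>H\<close> vanishes at
    \<open>2 ^ J\<close>. Its size is harmless because the final bounds do not involve
    \<open>J\<close>.\<close>
  define J where "J = \<Prod>A"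
  \<comment> \<open>Chosen so that \<open>1 / (1 - q) = U\<close> and
    \<open>2 powr -(\<epsilon> / 2) \<le> q ^ 4\<close>: the variance at level \<open>i\<close> then
    decays faster than the squared threshold, which is of order \<open>q ^ (2 * i)\<close>.\<close>
  define q where "q = 1 / (1 + \<epsilon> / 16)"
  \<comment> \<open>Geometric thresholds keep the sum over the unboundedly many dyadic levels independent of \<open>A\<close>.\<close>
  define l where "l i = exp (-R) * (1 - q) * q ^ i" for i :: nat
  define c where "c i a T = (if \<Prod>T div 2 ^ i = a then real (\<Prod>T) powr -(1/2 + \<epsilon>) else 0)" for i a and T :: "nat set"
  define V where "V i a = (\<Sum>T\<in>Pow A. (c i a T)\<^sup>2 * (2 * real k - 1) ^ card T)" for i a
  define I where "I i = {a \<in> {1..<2 ^ J}. x < real (a * 2 ^ i)}" for i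
  define B where "B = exp (2 * R) * x powr -(\<epsilon> / 2) * U ^ (2 * k + 1)"
  define E where "E i a = {S \<in> Pow A. l i \<le> \<bar>\<Sum>T\<in>Pow A. c i a T * walsh S T\<bar>}" for i a
  have q: "0 < q" "q < 1" using assms by (auto simp: q_def field_simps)
  have U1: "U \<ge> 1" using assms by simp
  have qU: "1 / (1 - q) = U" using assms unfolding q_def U_def by (simp add: field_simps)
  have l: "l i > 0" for i using q by (simp add: l_def)
  have le_J: "\<Prod>T \<le> J" if "T \<in> Pow A" for T
    unfolding J_def using that A
    by (intro dvd_imp_le prod_dvd_prod_subset prod_primes_pos) auto
  have "J < 2 ^ J" by (rule less_exp)
  have tail_zero: "H S N = 0" if "J < N" for S N
  proof -
    have "{T. T \<in> Pow A \<and> N \<le> \<Prod>T} = {}"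
      using that le_J by (metis (mono_tags, lifting) empty_Collect_eq le_trans not_le)
    then show ?thesis unfolding H_def by (simp only: sum.empty)
  qed
  have block: "H S (a * 2 ^ i) - H S ((a + 1) * 2 ^ i) = (\<Sum>T\<in>Pow A. c i a T * walsh S T)" for S a i
  proof -
    have div: "\<Prod>T div 2 ^ i = a \<longleftrightarrow> a * 2 ^ i \<le> \<Prod>T \<and> \<not> (a + 1) * 2 ^ i \<le> \<Prod>T" for T :: "nat set"
      using less_eq_div_iff_mult_less_eq[of "2 ^ i" a "\<Prod>T"] less_eq_div_iff_mult_less_eq[of "2 ^ i" "a + 1" "\<Prod>T"]
      by auto
    have split: "H S M = (\<Sum>T\<in>Pow A. if M \<le> \<Prod>T then real (\<Prod>T) powr -(1/2 + \<epsilon>) * walsh S T else 0)" for M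
      unfolding H_def using A by (subst sum.inter_filter[symmetric]) auto
    show ?thesis
      unfolding split sum_subtractf[symmetric]
    proof (intro sum.cong refl)
      fix T :: "nat set"
      have "a * 2 ^ i \<le> \<Prod>T" if "(a + 1) * 2 ^ i \<le> \<Prod>T" using that by simp
      then show "(if a * 2 ^ i \<le> \<Prod>T then real (\<Prod>T) powr -(1/2 + \<epsilon>) * walsh S T else 0) -
        (if (a + 1) * 2 ^ i \<le> \<Prod>T then real (\<Prod>T) powr -(1/2 + \<epsilon>) * walsh S T else 0) = c i a T * walsh S T"
        unfolding c_def div by auto
    qed
  qed
  have sum_l: "(\<Sum>i<J. l i) \<le> exp (-R)"
  proof -
    have "(\<Sum>i<J. l i) = exp (-R) * ((1 - q) * (\<Sum>i<J. q ^ i))"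
      by (simp add: l_def sum_distrib_left mult.assoc)
    also have "(1 - q) * (\<Sum>i<J. q ^ i) = 1 - q ^ J"
      by (rule one_diff_power_eq[symmetric])
    also have "exp (-R) * (1 - q ^ J) \<le> exp (-R) * 1"
      using q by (intro mult_left_mono) auto
    finally show ?thesis by simp
  qed
  have sub: "{S \<in> Pow A. \<exists>N. x < real N \<and> exp (-R) < \<bar>H S N\<bar>} \<subseteq> (\<Union>i<J. \<Union>a\<in>I i. E i a)"
  proof
    fix S assume "S \<in> {S \<in> Pow A. \<exists>N. x < real N \<and> exp (-R) < \<bar>H S N\<bar>}"
    then obtain N where S: "S \<in> Pow A" and N: "x < real N" "exp (-R) < \<bar>H S N\<bar>" by auto
    have "N \<le> J" using N tail_zero[of N S] by (metis abs_zero exp_gt_zero less_asym not_le)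
    then have NJ: "N \<le> 2 ^ J" using \<open>J < 2 ^ J\<close> by linarith
    have N1: "1 \<le> N" using N \<open>1 \<le> x\<close> by linarith
    show "S \<in> (\<Union>i<J. \<Union>a\<in>I i. E i a)"
    proof (rule ccontr)
      assume contra: "S \<notin> (\<Union>i<J. \<Union>a\<in>I i. E i a)"
      have "\<bar>H S (a * 2 ^ i) - H S ((a + 1) * 2 ^ i)\<bar> \<le> l i" if "i < J" "1 \<le> a" "a < 2 ^ J" "N \<le> a * 2 ^ i" for i a
      proof -
        have "x < real (a * 2 ^ i)" using N that of_nat_mono[OF that(4)] by (metis less_le_trans)
        then have "a \<in> I i" using that by (simp add: I_def)
        then have "S \<notin> E i a" using contra that by auto
        then show ?thesis unfolding block using S by (auto simp: E_def)
      qed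
      then have "\<bar>H S N - H S (2 ^ J)\<bar> \<le> (\<Sum>i<J. l i)"
        using less_imp_le[OF l] by (rule dyadic_chain[OF N1 NJ])
      then show False using N sum_l tail_zero[OF \<open>J < 2 ^ J\<close>, of S] by simp
    qed
  qed
  have V_nonneg: "0 \<le> V i a" for i a
    using assms by (auto simp: V_def intro!: sum_nonneg)
  have sum_V: "(\<Sum>a\<in>I i. V i a) / (l i)\<^sup>2 \<le> B * q ^ i" for i
  proof -
    \<comment> \<open>Products in the admissible blocks exceed \<open>x\<close>, and are at least
      \<open>2 ^ i\<close> since \<open>a \<ge> 1\<close>. Half of the decay
      \<open>m powr -\<epsilon>\<close> is spent on each: one gives the saving in \<open>x\<close>,
      the other summability over \<open>i\<close>.\<close>
    define m where "m = max x (2 ^ i)"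
    let ?v = "\<lambda>T. real (\<Prod>T) powr -(1 + 2 * \<epsilon>) * (2 * real k - 1) ^ card T"
    have "(\<Sum>a\<in>I i. V i a) = (\<Sum>a\<in>I i. \<Sum>T | T \<in> Pow A \<and> \<Prod>T div 2 ^ i = a. ?v T)"
    proof (intro sum.cong refl)
      fix a
      have "V i a = (\<Sum>T\<in>Pow A. if \<Prod>T div 2 ^ i = a then ?v T else 0)"
        unfolding V_def c_def
        by (intro sum.cong refl) (simp only: if_distrib[of "\<lambda>z. z\<^sup>2"] if_distrib[of "\<lambda>z. z * _"] powr_half_square, simp)
      then show "V i a = (\<Sum>T | T \<in> Pow A \<and> \<Prod>T div 2 ^ i = a. ?v T)"
        using A by (subst sum.inter_filter) auto
    qed
    also have "\<dots> = (\<Sum>a\<in>I i. \<Sum>T | T \<in> {T \<in> Pow A. \<Prod>T div 2 ^ i \<in> I i} \<and> \<Prod>T div 2 ^ i = a. ?v T)"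
      by (intro sum.cong refl) auto
    also have "\<dots> = (\<Sum>T\<in>{T \<in> Pow A. \<Prod>T div 2 ^ i \<in> I i}. ?v T)"
      using A by (intro sum.group) (auto simp: I_def)
    also have "\<dots> \<le> (\<Sum>T | T \<in> Pow A \<and> m \<le> real (\<Prod>T). ?v T)"
    proof (rule sum_mono2)
      show "{T \<in> Pow A. \<Prod>T div 2 ^ i \<in> I i} \<subseteq> {T. T \<in> Pow A \<and> m \<le> real (\<Prod>T)}"
      proof safe
        fix T assume "\<Prod>T div 2 ^ i \<in> I i"
        then have *: "1 \<le> \<Prod>T div 2 ^ i" "x < real (\<Prod>T div 2 ^ i * 2 ^ i)" by (auto simp: I_def)
        have le: "\<Prod>T div 2 ^ i * 2 ^ i \<le> \<Prod>T" by (rule div_times_less_eq_dividend)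
        have "1 * 2 ^ i \<le> \<Prod>T div 2 ^ i * 2 ^ i" using *(1) by (intro mult_right_mono) auto
        then have "2 ^ i \<le> \<Prod>T" using le by linarith
        then have "real (2 ^ i) \<le> real (\<Prod>T)" by (rule of_nat_mono)
        moreover have "real (\<Prod>T div 2 ^ i * 2 ^ i) \<le> real (\<Prod>T)" using le by (rule of_nat_mono)
        ultimately show "m \<le> real (\<Prod>T)" using *(2) unfolding m_def by simp
      qed
    qed (use assms in auto)
    also have "\<dots> \<le> m powr -\<epsilon> * (1 + 1 / \<epsilon>) ^ (2 * k - 1)"
      using assms by (intro sum_Pow_tail_le) (auto simp: m_def)
    also have "\<dots> \<le> (x powr -(\<epsilon> / 2) * q ^ (4 * i)) * U ^ (2 * k - 1)"
    proof (intro mult_mono power_mono)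
      have "m powr -\<epsilon> = m powr -(\<epsilon> / 2) * m powr -(\<epsilon> / 2)" by (simp flip: powr_add)
      also have "\<dots> \<le> x powr -(\<epsilon> / 2) * (2 ^ i) powr -(\<epsilon> / 2)"
        using assms by (intro mult_mono powr_mono2') (auto simp: m_def)
      also have "((2::real) ^ i) powr -(\<epsilon> / 2) = (2 powr -(\<epsilon> / 2)) ^ i"
        by (simp add: powr_powr mult.commute flip: powr_realpow)
      also have "2 powr -(\<epsilon> / 2) \<le> q ^ 4"
      proof -
        have "(1 + \<epsilon> / 16) ^ 4 \<le> exp (\<epsilon> / 16) ^ 4"
          using assms by (intro power_mono exp_ge_add_one_self) auto
        also have "\<dots> = exp (\<epsilon> / 4)" by (simp flip: exp_of_nat_mult)
        also have "\<dots> \<le> exp (\<epsilon> / 2 * ln 2)"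
          using assms ln2_ge_two_thirds by simp
        also have "\<dots> = 2 powr (\<epsilon> / 2)" by (simp add: powr_def)
        finally have "inverse (2 powr (\<epsilon> / 2)) \<le> inverse ((1 + \<epsilon> / 16) ^ 4)"
          using assms by (intro le_imp_inverse_le) (auto intro!: add_pos_pos)
        then show ?thesis by (simp add: q_def powr_minus power_divide inverse_eq_divide)
      qed
      then have "(2 powr -(\<epsilon> / 2)) ^ i \<le> (q ^ 4) ^ i" by (intro power_mono) auto
      then have "x powr -(\<epsilon> / 2) * (2 powr -(\<epsilon> / 2)) ^ i \<le> x powr -(\<epsilon> / 2) * q ^ (4 * i)"
        by (intro mult_left_mono) (auto simp: power_mult)
      finally show "m powr -\<epsilon> \<le> x powr -(\<epsilon> / 2) * q ^ (4 * i)" .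
      show "1 + 1 / \<epsilon> \<le> U" using assms by (simp add: field_simps)
    qed (use assms q in auto)
    finally have "(\<Sum>a\<in>I i. V i a) / (l i)\<^sup>2 \<le> x powr -(\<epsilon> / 2) * q ^ (4 * i) * U ^ (2 * k - 1) / (l i)\<^sup>2"
      by (intro divide_right_mono) auto
    \<comment> \<open>Dividing by \<open>(l i)\<^sup>2\<close> costs \<open>U ^ 2\<close> from
      \<open>1 - q\<close> and leaves \<open>q ^ (2 * i)\<close> of the decay
      \<open>q ^ (4 * i)\<close>.\<close>
    also have "\<dots> = B * q ^ (2 * i)"
    proof -
      have "U ^ (2 * k + 1) = U ^ (2 * k - 1) * U ^ 2" using assms by (simp flip: power_add)
      also have "U ^ 2 = 1 / (1 - q) ^ 2" by (simp add: qU[symmetric] power_divide)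
      finally have *: "U ^ (2 * k + 1) = U ^ (2 * k - 1) * (1 / (1 - q) ^ 2)" .
      have "q ^ (4 * i) = q ^ (2 * i) * q ^ (2 * i)" by (simp flip: power_add)
      moreover have "(q ^ i)\<^sup>2 = q ^ (2 * i)" by (simp add: mult.commute flip: power_mult)
      moreover have "exp (2 * R) = (exp R)\<^sup>2" by (simp add: exp_double)
      ultimately show ?thesis
        unfolding B_def l_def * using q by (simp add: exp_minus power_mult_distrib power_inverse divide_simps)
    qed
    also have "\<dots> \<le> B * q ^ i"
      using q U1 unfolding B_def by (intro mult_left_mono power_decreasing) auto
    finally show ?thesis .
  qed
  have B: "B \<ge> 0" using U1 by (simp add: B_def)
  have "real (card {S \<in> Pow A. \<exists>N. x < real N \<and> exp (-R) < \<bar>H S N\<bar>}) \<le> real (card (\<Union>i<J. \<Union>a\<in>I i. E i a))"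
    using sub A by (intro of_nat_mono card_mono) (auto simp: I_def E_def)
  also have "\<dots> \<le> (\<Sum>i<J. \<Sum>a\<in>I i. real (card (E i a)))"
  proof -
    have "card (\<Union>i<J. \<Union>a\<in>I i. E i a) \<le> (\<Sum>i<J. card (\<Union>a\<in>I i. E i a))"
      by (intro card_UN_le) auto
    also have "\<dots> \<le> (\<Sum>i<J. \<Sum>a\<in>I i. card (E i a))"
      by (intro sum_mono card_UN_le) (auto simp: I_def)
    finally show ?thesis by (simp flip: of_nat_sum)
  qed
  also have "\<dots> \<le> (\<Sum>i<J. \<Sum>a\<in>I i. 2 ^ card A * (V i a / (l i)\<^sup>2) ^ k)"
    unfolding E_def V_def using A l assms by (intro sum_mono walsh_tail_count)
  also have "\<dots> = 2 ^ card A * (\<Sum>i<J. \<Sum>a\<in>I i. (V i a / (l i)\<^sup>2) ^ k)"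
    by (simp add: sum_distrib_left)
  also have "\<dots> \<le> 2 ^ card A * (\<Sum>i<J. (\<Sum>a\<in>I i. V i a / (l i)\<^sup>2) ^ k)"
    using V_nonneg assms by (intro mult_left_mono sum_mono sum_power_le_power_sum) (auto simp: I_def)
  also have "\<dots> \<le> 2 ^ card A * (\<Sum>i<J. (B * q ^ i) ^ k)"
    unfolding sum_divide_distrib[symmetric] using sum_V V_nonneg
    by (intro mult_left_mono sum_mono power_mono divide_nonneg_nonneg sum_nonneg) auto
  \<comment> \<open>Since \<open>k \<ge> 1\<close>, one factor \<open>q ^ i\<close> suffices, and
    the geometric series contributes at most \<open>U\<close>.\<close>
  also have "\<dots> \<le> 2 ^ card A * (\<Sum>i<J. B ^ k * q ^ i)"
  proof (intro mult_left_mono sum_mono)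
    fix i
    have "(q ^ i) ^ k \<le> (q ^ i) ^ 1"
      using assms q by (intro power_decreasing) (auto intro: power_le_one)
    then show "(B * q ^ i) ^ k \<le> B ^ k * q ^ i"
      using B by (auto simp: power_mult_distrib intro!: mult_left_mono)
  qed auto
  also have "\<dots> = 2 ^ card A * (B ^ k * (\<Sum>i<J. q ^ i))"
    by (simp add: sum_distrib_left)
  also have "\<dots> \<le> 2 ^ card A * (B ^ k * U)"
  proof (intro mult_left_mono)
    have "(\<Sum>i<J. q ^ i) = (1 - q ^ J) / (1 - q)"
      using q one_diff_power_eq[of q J] by (simp add: field_simps)
    also have "\<dots> \<le> 1 / (1 - q)" using q by (intro divide_right_mono) auto
    finally show "(\<Sum>i<J. q ^ i) \<le> U" using qU by simp
  qed (use B in auto)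
  finally show ?thesis unfolding B_def .
qed

text \<open>The partial sum is \<open>?F S - ?H S N\<close>, so it can fail to be positive only if
  \<open>?F S \<le> exp (-R)\<close> or \<open>\<bar>?H S N\<bar> > exp (-R)\<close>. The parameters
  \<open>R\<close> and \<open>k\<close> make both counts obey the same bound.\<close>

lemma nonpositive_partial_sum_count:
  fixes A :: "nat set"
  assumes A: "finite A" "\<And>p. p \<in> A \<Longrightarrow> prime p" and "0 < \<epsilon>" "1 \<le> x"
    and large: "48 * ln (1 + 16 / \<epsilon>) \<le> \<epsilon> * ln x"
  shows "real (card {S \<in> Pow A. \<exists>N. x < real N \<and>
      (\<Sum>T | T \<in> Pow A \<and> \<Prod>T < N. real (\<Prod>T) powr -(1/2 + \<epsilon>) * walsh S T) \<le> 0})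
    \<le> 2 ^ card A * (2 * exp (- (\<epsilon> * ln x)\<^sup>2 / (768 * ln (1 + 16 / \<epsilon>))))"
proof -
  define U where "U = 1 + 16 / \<epsilon>"
  define u where "u = ln U"
  define z where "z = \<epsilon> * ln x"
  \<comment> \<open>This balances the two events: \<open>exp (-2 * R)\<close> and
    \<open>exp (2 * R) * x powr -(\<epsilon> / 2)\<close> both equal
    \<open>exp (- z / 4)\<close>.\<close>
  define R where "R = z / 8"
  \<comment> \<open>Small enough that the powers of \<open>U\<close> cost at most half of the saving
    \<open>z / 4\<close>; the hypothesis \<open>large\<close> ensures
    \<open>k \<ge> 1\<close>.\<close>
  define k where "k = nat \<lfloor>z / (48 * u)\<rfloor>"
  let ?w = "\<lambda>T. real (\<Prod>T) powr -(1/2 + \<epsilon>)"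
  let ?F = "\<lambda>S. \<Sum>T\<in>Pow A. ?w T * walsh S T"
  let ?H = "\<lambda>S N. \<Sum>T | T \<in> Pow A \<and> N \<le> \<Prod>T. ?w T * walsh S T"
  let ?P = "\<lambda>S N. \<Sum>T | T \<in> Pow A \<and> \<Prod>T < N. ?w T * walsh S T"
  let ?E1 = "{S \<in> Pow A. ?F S \<le> exp (-R)}"
  let ?E2 = "{S \<in> Pow A. \<exists>N. x < real N \<and> exp (-R) < \<bar>?H S N\<bar>}"
  let ?D = "exp (- z\<^sup>2 / (768 * u))"
  have U: "U > 1" using assms by (simp add: U_def)
  then have u: "u > 0" by (simp add: u_def)
  have expu: "U = exp u" using U by (simp add: u_def)
  have z: "48 * u \<le> z" using large by (simp add: u_def U_def z_def)
  have quot: "1 \<le> z / (48 * u)" using z u by simp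
  then have k: "real k \<le> z / (48 * u)" "z / (48 * u) < real k + 1" "1 \<le> k"
    by (auto simp: k_def le_nat_iff le_floor_iff intro: order_trans[OF _ of_int_floor_le])
  have k1: "real k * (48 * u) \<le> z" using k(1) u by (simp add: field_simps)
  have k2: "z \<le> real k * (96 * u)"
  proof -
    have "z < (real k + 1) * (48 * u)" using k(2) u by (simp add: field_simps)
    also have "\<dots> \<le> (real k + real k) * (48 * u)" using k(3) u by (intro mult_right_mono) auto
    finally show ?thesis by simp
  qed
  \<comment> \<open>As \<open>(2k + 3) u \<le> 5 k u \<le> 5z / 48\<close>, the bracket is at most
    \<open>- z / 8\<close>; then \<open>k \<ge> z / (96 u)\<close> produces 768 as
    \<open>8 * 96\<close>.\<close>
  have expo: "real k * (- z / 4 + (2 * real k + 3) * u) \<le> - z\<^sup>2 / (768 * u)"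
  proof -
    have "(2 * real k + 3) * u \<le> (5 * real k) * u" using k(3) u by (intro mult_right_mono) auto
    then have "- z / 4 + (2 * real k + 3) * u \<le> - z / 8" using k1 z u by linarith
    then have "real k * (- z / 4 + (2 * real k + 3) * u) \<le> real k * (- z / 8)" by (intro mult_left_mono) auto
    also have "\<dots> \<le> (z / (96 * u)) * (- z / 8)"
      using k2 z u by (intro mult_right_mono_neg) (auto simp: field_simps)
    also have "\<dots> = - z\<^sup>2 / (768 * u)" by (simp add: power2_eq_square)
    finally show ?thesis .
  qed
  have "real (card ?E1) \<le> 2 ^ card A * (exp (-2 * R) * (1 + 1 / \<epsilon>) ^ (2 * k + 3)) ^ k"
    using assms k by (intro euler_product_small_count) auto
  also have "\<dots> \<le> 2 ^ card A * (exp (-2 * R) * U ^ (2 * k + 3)) ^ k"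
    using assms by (intro mult_left_mono power_mono) (auto simp: U_def field_simps)
  also have "\<dots> = 2 ^ card A * exp (real k * (- z / 4 + (2 * real k + 3) * u))"
    by (simp add: expu R_def flip: exp_of_nat_mult exp_add)
  also have "\<dots> \<le> 2 ^ card A * ?D"
    using expo by (intro mult_left_mono) auto
  finally have E1: "real (card ?E1) \<le> 2 ^ card A * ?D" .
  have "real (card ?E2) \<le> 2 ^ card A * ((exp (2 * R) * x powr -(\<epsilon> / 2) * U ^ (2 * k + 1)) ^ k * U)"
    unfolding U_def using assms k by (intro tail_count) auto
  also have "x powr -(\<epsilon> / 2) = exp (- z / 2)"
    using assms by (simp add: powr_def z_def)
  also have "(exp (2 * R) * exp (- z / 2) * U ^ (2 * k + 1)) ^ k * U
      = exp (real k * (- z / 4 + (2 * real k + 1) * u) + u)"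
    by (simp add: algebra_simps expu R_def flip: exp_of_nat_mult exp_add)
  also have "2 ^ card A * \<dots> \<le> 2 ^ card A * ?D"
  proof (intro mult_left_mono)
    \<comment> \<open>The extra factor \<open>U = exp u\<close> fits into the slack between
      \<open>2k + 1\<close> and \<open>2k + 3\<close>.\<close>
    have "1 * u \<le> real k * (2 * u)" using k u by (intro mult_mono) auto
    then have "real k * (- z / 4 + (2 * real k + 1) * u) + u \<le> real k * (- z / 4 + (2 * real k + 3) * u)"
      by (simp add: algebra_simps)
    with expo show "exp (real k * (- z / 4 + (2 * real k + 1) * u) + u) \<le> ?D" by simp
  qed auto
  finally have E2: "real (card ?E2) \<le> 2 ^ card A * ?D" .
  have "{S \<in> Pow A. \<exists>N. x < real N \<and> ?P S N \<le> 0} \<subseteq> ?E1 \<union> ?E2"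
  proof
    fix S assume "S \<in> {S \<in> Pow A. \<exists>N. x < real N \<and> ?P S N \<le> 0}"
    then obtain N where S: "S \<in> Pow A" "x < real N" "?P S N \<le> 0" by auto
    have "?F S = sum (\<lambda>T. ?w T * walsh S T) ({T. T \<in> Pow A \<and> \<Prod>T < N} \<union> {T. T \<in> Pow A \<and> N \<le> \<Prod>T})"
      by (intro sum.cong) auto
    also have "\<dots> = ?P S N + ?H S N"
      using A by (intro sum.union_disjoint) auto
    finally show "S \<in> ?E1 \<union> ?E2" using S by force
  qed
  then have "card {S \<in> Pow A. \<exists>N. x < real N \<and> ?P S N \<le> 0} \<le> card (?E1 \<union> ?E2)"
    using A by (intro card_mono) auto
  also have "\<dots> \<le> card ?E1 + card ?E2" by (rule card_Un_le)
  finally have "real (card {S \<in> Pow A. \<exists>N. x < real N \<and> ?P S N \<le> 0}) \<le> real (card ?E1 + card ?E2)"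
    by (rule of_nat_mono)
  then show ?thesis using E1 E2 unfolding z_def u_def U_def by simp
qed

section \<open>Squarefree numbers as products of sets of primes\<close>

lemma squarefree_eq_prod_prime_factors:
  fixes n :: nat
  assumes "squarefree n"
  shows "\<Prod>(prime_factors n) = n"
proof -
  have "n \<noteq> 0" using assms by (metis not_squarefree_0)
  then have "(\<Prod>p\<in>prime_factors n. p ^ multiplicity p n) = n"
    using prod_prime_factors[of n] by simp
  moreover have "multiplicity p n = 1" if "p \<in> prime_factors n" for p
    using assms \<open>n \<noteq> 0\<close> that by (simp add: squarefree_factorial_semiring')
  ultimately show ?thesis by simp
qed

lemma squarefree_prod_primes:
  fixes T :: "nat set"
  assumes "\<And>p. p \<in> T \<Longrightarrow> prime p"
  shows "squarefree (\<Prod>T)"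
  using assms by (intro squarefree_prod_coprime) (auto intro: primes_coprime squarefree_prime)

section \<open>Transfer to the random multiplicative function\<close>

context rademacher_random_multiplicative
begin

lemma f_measurable:
  assumes "0 < n"
  shows "f n \<in> borel_measurable M"
proof -
  have "f p \<in> borel_measurable M" if "p \<in> prime_factors n" for p
    using indep_primes that by (auto simp: indep_vars_def)
  then have "(\<lambda>\<omega>. (moebius_mu n)\<^sup>2 * (\<Prod>p\<in>prime_factors n. f p \<omega>)) \<in> borel_measurable M"
    by measurable
  then show ?thesis
    using multiplicative_extension[OF assms] by (subst measurable_cong) auto
qed

lemma prob_signs:
  assumes "finite A" "\<And>p. p \<in> A \<Longrightarrow> prime p"
  shows "prob {\<omega> \<in> space M. \<forall>p\<in>A. f p \<omega> = (if p \<in> S then 1 else -1)} = 1 / 2 ^ card A"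
\<comment> \<open>The empty intersection would be the whole type rather than \<open>space M\<close>,
  so this case is separate.\<close>
proof (cases "A = {}")
  case True
  then show ?thesis by (simp add: prob_space)
next
  case False
  let ?e = "\<lambda>p. if p \<in> S then 1 else -1 :: real"
  have "indep_sets (\<lambda>i. {f i -` B \<inter> space M | B. B \<in> sets borel}) {p. prime p}"
    using indep_primes by (simp add: indep_vars_def2)
  then have "prob (\<Inter>p\<in>A. f p -` {?e p} \<inter> space M) = (\<Prod>p\<in>A. prob (f p -` {?e p} \<inter> space M))"
    using assms False by (intro indep_setsD) auto
  also have "\<dots> = (\<Prod>p\<in>A. 1 / 2)"
  proof (intro prod.cong refl)
    fix p assume "p \<in> A"
    moreover have "f p -` {c} \<inter> space M = {\<omega> \<in> space M. f p \<omega> = c}" for c by auto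
    ultimately show "prob (f p -` {?e p} \<inter> space M) = 1 / 2"
      using prob_plus_one prob_minus_one assms by simp
  qed
  also have "(\<Inter>p\<in>A. f p -` {?e p} \<inter> space M) = {\<omega> \<in> space M. \<forall>p\<in>A. f p \<omega> = ?e p}"
    using False by auto
  finally show ?thesis by (simp add: power_divide)
qed

text \<open>The bridge from counting to probability. Up to the null events where some
  \<open>f p\<close> is not a sign, \<open>E\<close> is covered by the cylinders of the patterns in
  \<open>B\<close>, each of probability \<open>1 / 2 ^ card A\<close>.\<close>

lemma prob_le_card_signs:
  assumes A: "finite A" "\<And>p. p \<in> A \<Longrightarrow> prime p" and E: "E \<in> events" and B: "B \<subseteq> Pow A"
    and sub: "\<And>\<omega>. \<omega> \<in> E \<Longrightarrow> (\<forall>p\<in>A. f p \<omega> = 1 \<or> f p \<omega> = -1) \<Longrightarrow> {p \<in> A. f p \<omega> = 1} \<in> B"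
  shows "prob E \<le> real (card B) / 2 ^ card A"
proof -
  let ?N = "\<lambda>p. {\<omega> \<in> space M. f p \<omega> \<noteq> 1 \<and> f p \<omega> \<noteq> -1}"
  let ?C = "\<lambda>S. {\<omega> \<in> space M. \<forall>p\<in>A. f p \<omega> = (if p \<in> S then 1 else -1)}"
  have meas [measurable]: "f p \<in> borel_measurable M" if "p \<in> A" for p
    using f_measurable that A prime_gt_0_nat by blast
  have null: "prob (?N p) = 0" if "p \<in> A" for p
  proof -
    note [measurable] = meas[OF that]
    have "prob ({\<omega> \<in> space M. f p \<omega> = 1} \<union> {\<omega> \<in> space M. f p \<omega> = -1}) = 1 / 2 + 1 / 2"
      using prob_plus_one[OF A(2)[OF that]] prob_minus_one[OF A(2)[OF that]] by (subst finite_measure_Union) auto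
    then have "prob (space M - ({\<omega> \<in> space M. f p \<omega> = 1} \<union> {\<omega> \<in> space M. f p \<omega> = -1})) = 0"
      by (subst prob_compl) auto
    also have "space M - ({\<omega> \<in> space M. f p \<omega> = 1} \<union> {\<omega> \<in> space M. f p \<omega> = -1}) = ?N p" by auto
    finally show ?thesis .
  qed
  have N_meas: "?N p \<in> events" if "p \<in> A" for p
    using meas[OF that] by measurable
  have C_meas: "?C S \<in> events" for S
    using A by (intro sets.sets_Collect_finite_All) (auto intro: borel_measurable_eq meas)
  have fB: "finite B" using B A finite_subset by blast
  have "E \<subseteq> (\<Union>S\<in>B. ?C S) \<union> (\<Union>p\<in>A. ?N p)"
  proof
    fix \<omega> assume w: "\<omega> \<in> E"
    then have ws: "\<omega> \<in> space M" using E sets.sets_into_space by auto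
    show "\<omega> \<in> (\<Union>S\<in>B. ?C S) \<union> (\<Union>p\<in>A. ?N p)"
    proof (cases "\<forall>p\<in>A. f p \<omega> = 1 \<or> f p \<omega> = -1")
      case True
      then have "\<omega> \<in> ?C {p \<in> A. f p \<omega> = 1}" using ws by auto
      then show ?thesis using sub[OF w True] by blast
    qed (use ws in auto)
  qed
  then have "prob E \<le> prob ((\<Union>S\<in>B. ?C S) \<union> (\<Union>p\<in>A. ?N p))"
    using C_meas N_meas fB A by (intro finite_measure_mono sets.Un sets.finite_UN) auto
  also have "\<dots> \<le> prob (\<Union>S\<in>B. ?C S) + prob (\<Union>p\<in>A. ?N p)"
    using C_meas N_meas fB A by (intro measure_Un_le sets.finite_UN) auto
  also have "\<dots> \<le> (\<Sum>S\<in>B. prob (?C S)) + (\<Sum>p\<in>A. prob (?N p))"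
    using C_meas N_meas fB A by (intro add_mono finite_measure_subadditive_finite) auto
  also have "\<dots> = real (card B) / 2 ^ card A"
    using null A by (simp add: prob_signs)
  finally show ?thesis .
qed

text \<open>Every \<open>n < N\<close> is at most \<open>X\<close>, so all its primes lie in
  \<open>A\<close>. Squarefree \<open>n\<close> correspond to their sets of prime factors, and the
  other terms vanish.\<close>

lemma partial_sum_eq_walsh:
  assumes A: "A = {p. prime p \<and> p \<le> X}" and "N \<le> Suc X" and w: "\<omega> \<in> space M"
    and signs: "\<forall>p\<in>A. f p \<omega> = 1 \<or> f p \<omega> = -1"
  shows "(\<Sum>n | 1 \<le> n \<and> n < N. f n \<omega> / real n powr \<sigma>)
    = (\<Sum>T | T \<in> Pow A \<and> \<Prod>T < N. real (\<Prod>T) powr -\<sigma> * walsh {p \<in> A. f p \<omega> = 1} T)"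
proof -
  let ?S = "{p \<in> A. f p \<omega> = 1}"
  let ?I = "{T. T \<in> Pow A \<and> \<Prod>T < N}"
  have fin: "finite A" unfolding A by (rule finite_subset[of _ "{..X}"]) auto
  have primes: "\<And>p. p \<in> A \<Longrightarrow> prime p" using A by auto
  have "inj_on (\<lambda>T. \<Prod>T) ?I"
    by (rule inj_on_subset[OF inj_on_prod_primes[OF fin primes]]) auto
  then have "(\<Sum>n\<in>(\<lambda>T. \<Prod>T) ` ?I. f n \<omega> / real n powr \<sigma>) = (\<Sum>T\<in>?I. f (\<Prod>T) \<omega> / real (\<Prod>T) powr \<sigma>)"
    by (rule sum.reindex_cong) auto
  also have "\<dots> = (\<Sum>T\<in>?I. real (\<Prod>T) powr -\<sigma> * walsh ?S T)"
  proof (intro sum.cong refl)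
    fix T assume "T \<in> ?I"
    then have T: "T \<subseteq> A" "finite T" using fin finite_subset by auto
    have pf: "prime_factors (\<Prod>T) = T" using T primes by (intro prime_factors_prod_primes) auto
    have sf: "squarefree (\<Prod>T)" using T primes by (intro squarefree_prod_primes) auto
    have "f (\<Prod>T) \<omega> = (moebius_mu (\<Prod>T))\<^sup>2 * (\<Prod>p\<in>prime_factors (\<Prod>T). f p \<omega>)"
      using T primes w by (intro multiplicative_extension prod_primes_pos) auto
    also have "\<dots> = (\<Prod>p\<in>T. f p \<omega>)"
      using sf unfolding pf by (simp add: moebius_mu_def flip: power_mult)
    also have "\<dots> = walsh ?S T"
      unfolding walsh_def using T signs by (intro prod.cong) auto
    finally show "f (\<Prod>T) \<omega> / real (\<Prod>T) powr \<sigma> = real (\<Prod>T) powr -\<sigma> * walsh ?S T"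
      by (simp only: powr_minus divide_inverse mult.commute)
  qed
  also have "(\<Sum>n\<in>(\<lambda>T. \<Prod>T) ` ?I. f n \<omega> / real n powr \<sigma>) = (\<Sum>n | 1 \<le> n \<and> n < N. f n \<omega> / real n powr \<sigma>)"
  proof (rule sum.mono_neutral_left)
    show "(\<lambda>T. \<Prod>T) ` ?I \<subseteq> {n. 1 \<le> n \<and> n < N}"
    proof safe
      fix T assume "T \<subseteq> A"
      then have "0 < \<Prod>T" using primes by (intro prod_primes_pos) auto
      then show "1 \<le> \<Prod>T" by linarith
    qed
    show "\<forall>n\<in>{n. 1 \<le> n \<and> n < N} - (\<lambda>T. \<Prod>T) ` ?I. f n \<omega> / real n powr \<sigma> = 0"
    proof
      fix n assume n: "n \<in> {n. 1 \<le> n \<and> n < N} - (\<lambda>T. \<Prod>T) ` ?I"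
      have "\<not> squarefree n"
      proof
        assume "squarefree n"
        then have *: "\<Prod>(prime_factors n) = n" by (rule squarefree_eq_prod_prime_factors)
        have "prime_factors n \<subseteq> A"
          using n \<open>N \<le> Suc X\<close> by (auto simp: A prime_factors_dvd dest!: dvd_imp_le)
        then have "n \<in> (\<lambda>T. \<Prod>T) ` ?I"
          using * n by (intro image_eqI[of _ _ "prime_factors n"]) auto
        then show False using n by simp
      qed
      then have "f n \<omega> = 0"
        using multiplicative_extension[of n \<omega>] n w by (simp add: moebius_mu_def)
      then show "f n \<omega> / real n powr \<sigma> = 0" by simp
    qed
  qed auto
  finally show ?thesis .
qed

text \<open>For each \<open>X\<close> only primes up to \<open>X\<close> matter and the counting
  bound is uniform in \<open>X\<close>. The events \<open>?G X\<close> decrease to the desired one,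
  so continuity from above passes the bound to the limit.\<close>

lemma prob_partial_sums_positive:
  assumes "0 < \<epsilon>" "1 \<le> x" and large: "48 * ln (1 + 16 / \<epsilon>) \<le> \<epsilon> * ln x"
  shows "prob {\<omega> \<in> space M. \<forall>y>x. partial_sum (\<lambda>n. f n \<omega>) (1/2 + \<epsilon>) y > 0}
    \<ge> 1 - 2 * exp (- (\<epsilon> * ln x)\<^sup>2 / (768 * ln (1 + 16 / \<epsilon>)))"
proof -
  \<comment> \<open>The strict bound \<open>n < N\<close> makes \<open>y\<close> correspond to
    \<open>N = \<lfloor>y\<rfloor> + 1\<close>, so that \<open>y > x\<close> gives
    \<open>N > x\<close>.\<close>
  define P where "P N \<omega> = (\<Sum>n | 1 \<le> n \<and> n < N. f n \<omega> / real n powr (1/2 + \<epsilon>))" for N \<omega>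
  define D where "D = 2 * exp (- (\<epsilon> * ln x)\<^sup>2 / (768 * ln (1 + 16 / \<epsilon>)))"
  let ?G = "\<lambda>X. {\<omega> \<in> space M. \<forall>N\<in>{..X}. x < real N \<longrightarrow> 0 < P N \<omega>}"
  have partial_sum_eq: "partial_sum (\<lambda>n. f n \<omega>) (1/2 + \<epsilon>) y = P (nat \<lfloor>y\<rfloor> + 1) \<omega>" if "0 \<le> y" for y \<omega>
    unfolding partial_sum_def P_def using that
    by (intro sum.cong) (auto simp: le_nat_floor less_Suc_eq_le le_nat_iff le_floor_iff)
  have P_meas [measurable]: "P N \<in> borel_measurable M" for N
    unfolding P_def by (intro borel_measurable_sum borel_measurable_divide f_measurable) auto
  have G_meas: "?G X \<in> events" for X by measurable
  have "prob (?G X) \<ge> 1 - D" for X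
  proof -
    define A where "A = {p. prime p \<and> p \<le> X}"
    have A: "finite A" "\<And>p. p \<in> A \<Longrightarrow> prime p"
      unfolding A_def by (auto intro: finite_subset[of _ "{..X}"])
    define B where "B = {S \<in> Pow A. \<exists>N. x < real N \<and>
      (\<Sum>T | T \<in> Pow A \<and> \<Prod>T < N. real (\<Prod>T) powr -(1/2 + \<epsilon>) * walsh S T) \<le> 0}"
    have "prob (space M - ?G X) \<le> real (card B) / 2 ^ card A"
    proof (rule prob_le_card_signs[OF A])
      fix \<omega> assume w: "\<omega> \<in> space M - ?G X" and signs: "\<forall>p\<in>A. f p \<omega> = 1 \<or> f p \<omega> = -1"
      then obtain N where N: "N \<le> X" "x < real N" "P N \<omega> \<le> 0" by force
      then have "(\<Sum>T | T \<in> Pow A \<and> \<Prod>T < N. real (\<Prod>T) powr -(1/2 + \<epsilon>) * walsh {p \<in> A. f p \<omega> = 1} T) \<le> 0"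
        using partial_sum_eq_walsh[OF A_def _ _ signs, of N "1/2 + \<epsilon>"] w unfolding P_def by simp
      then show "{p \<in> A. f p \<omega> = 1} \<in> B"
        unfolding B_def using N by blast
    qed (use G_meas in \<open>auto simp: B_def\<close>)
    also have "\<dots> \<le> 2 ^ card A * D / 2 ^ card A"
      unfolding B_def D_def using assms A
      by (intro divide_right_mono nonpositive_partial_sum_count) auto
    finally show ?thesis using prob_compl[OF G_meas[of X]] by simp
  qed
  moreover have "(\<lambda>X. prob (?G X)) \<longlonglongrightarrow> prob (\<Inter>X. ?G X)"
    using G_meas by (intro finite_Lim_measure_decseq) (auto simp: decseq_def)
  ultimately have "1 - D \<le> prob (\<Inter>X. ?G X)"
    by (intro LIMSEQ_le_const) auto
  also have "(\<Inter>X. ?G X) = {\<omega> \<in> space M. \<forall>y>x. partial_sum (\<lambda>n. f n \<omega>) (1/2 + \<epsilon>) y > 0}"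
  proof (intro set_eqI iffI)
    fix \<omega> assume w: "\<omega> \<in> (\<Inter>X. ?G X)"
    then have pos: "0 < P N \<omega>" if "x < real N" for N using that by blast
    have "partial_sum (\<lambda>n. f n \<omega>) (1/2 + \<epsilon>) y > 0" if "y > x" for y
    proof -
      have "x < real (nat \<lfloor>y\<rfloor> + 1)" using that assms by linarith
      then show ?thesis using pos partial_sum_eq[of y \<omega>] that assms by simp
    qed
    then show "\<omega> \<in> {\<omega> \<in> space M. \<forall>y>x. partial_sum (\<lambda>n. f n \<omega>) (1/2 + \<epsilon>) y > 0}"
      using w by auto
  next
    fix \<omega> assume w: "\<omega> \<in> {\<omega> \<in> space M. \<forall>y>x. partial_sum (\<lambda>n. f n \<omega>) (1/2 + \<epsilon>) y > 0}"
    have "0 < P N \<omega>" if N: "x < real N" for N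
    proof -
      \<comment> \<open>A point of \<open>[N - 1, N)\<close> above \<open>x\<close>: the midpoint of
        \<open>x\<close> and \<open>N\<close> serves when it exceeds \<open>N - 1\<close>.\<close>
      define y where "y = max (real N - 1) ((x + real N) / 2)"
      have y: "x < y" "0 \<le> y" "real N - 1 \<le> y" "y < real N" using N assms by (auto simp: y_def less_max_iff_disj)
      have "nat \<lfloor>y\<rfloor> + 1 = N" using y N assms by linarith
      then show ?thesis using w y partial_sum_eq[of y \<omega>] by auto
    qed
    then show "\<omega> \<in> (\<Inter>X. ?G X)" using w by auto
  qed
  finally show ?thesis unfolding D_def .
qed

end

section \<open>Choice of parameters\<close>

lemma eventually_log_le_power:
  fixes a :: real
  assumes "0 < a"
  shows "eventually (\<lambda>t. 48 * ln (1 + 16 * t) \<le> t powr a) at_top"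
  using assms by real_asymp

text \<open>The left denominator has the larger power \<open>1 + 2 * \<delta>\<close> of the
  logarithm, which eventually beats every constant; \<open>ln 2\<close> is absorbed because the
  right side tends to infinity.\<close>

lemma eventually_tail_bound:
  fixes a \<delta> \<theta> :: real
  assumes "0 < a" "0 < \<delta>" "0 < \<theta>"
  shows "eventually (\<lambda>t. ln 2 + 1 / (2 * \<theta>) * (t powr (2 * a) / (ln t / \<theta>) powr (1 + 2 * \<delta>))
    \<le> t powr (2 * a) / (768 * ln (1 + 16 * t))) at_top"
  using assms by real_asymp

theorem theorem1p1:
  fixes M :: "'a measure" and f :: "nat \<Rightarrow> 'a \<Rightarrow> real" and \<delta> \<theta> :: real
  assumes "rademacher_random_multiplicative M f"
    and "\<delta> > 0" and "0 < \<theta>" and "\<theta> < 1"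
  shows "\<exists>\<sigma>\<^sub>0::real. 1 / 2 < \<sigma>\<^sub>0 \<and> \<sigma>\<^sub>0 \<le> 1 \<and>
    (\<forall>(\<sigma>::real) (x::real). 1 / 2 < \<sigma> \<longrightarrow> \<sigma> \<le> \<sigma>\<^sub>0 \<longrightarrow> x \<ge> 1 \<longrightarrow>
      ln x = 1 / (\<sigma> - 1 / 2) powr (1 / \<theta>) \<longrightarrow>
      measure M {\<omega> \<in> space M. \<forall>y>x. partial_sum (\<lambda>n. f n \<omega>) \<sigma> y > 0}
        \<ge> 1 - exp (- (1 / (2 * \<theta>) * ((ln x) powr (2 - 2 * \<theta>) / (ln (ln x)) powr (1 + 2 * \<delta>)))))"
proof -
  interpret rademacher_random_multiplicative M f by fact
  define a where "a = 1 / \<theta> - 1"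
  have a: "a > 0" using assms by (simp add: a_def)
  obtain T where T: "\<And>t. t \<ge> T \<Longrightarrow> 48 * ln (1 + 16 * t) \<le> t powr a"
      "\<And>t. t \<ge> T \<Longrightarrow> ln 2 + 1 / (2 * \<theta>) * (t powr (2 * a) / (ln t / \<theta>) powr (1 + 2 * \<delta>))
        \<le> t powr (2 * a) / (768 * ln (1 + 16 * t))"
    using eventually_conj[OF eventually_log_le_power[OF a] eventually_tail_bound[OF a assms(2,3)]]
    unfolding eventually_at_top_linorder by blast
  \<comment> \<open>The bound 2 keeps \<open>1 / 2 + 1 / T'\<close> at most 1.\<close>
  define T' where "T' = max T 2"
  have T': "T' \<ge> T" "T' \<ge> 2" by (auto simp: T'_def)
  show ?thesis
  proof (rule exI[of _ "1 / 2 + 1 / T'"], intro conjI allI impI)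
    show "1 / 2 < 1 / 2 + 1 / T'" "1 / 2 + 1 / T' \<le> 1" using T' by (auto simp: field_simps)
    fix \<sigma> x :: real
    assume \<sigma>: "1 / 2 < \<sigma>" "\<sigma> \<le> 1 / 2 + 1 / T'" and x: "x \<ge> 1"
      and ln_x: "ln x = 1 / (\<sigma> - 1 / 2) powr (1 / \<theta>)"
    \<comment> \<open>In terms of \<open>t\<close> all quantities become explicit:
      \<open>ln x = t powr (1 / \<theta>)\<close>, hence \<open>\<epsilon> ln x = t powr a\<close>
      with \<open>\<epsilon> = 1 / t\<close>.\<close>
    define t where "t = 1 / (\<sigma> - 1 / 2)"
    have t0: "t > 0" using \<sigma> by (simp add: t_def)
    have eps: "\<sigma> - 1 / 2 = 1 / t" using \<sigma> by (simp add: t_def)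
    have "1 / t \<le> 1 / T'" using \<sigma> eps by linarith
    then have tT: "t \<ge> T'" using t0 T' by (simp add: field_simps)
    have L: "ln x = t powr (1 / \<theta>)"
      using t0 unfolding ln_x eps by (simp add: powr_divide)
    have z: "1 / t * ln x = t powr a"
      using t0 by (simp add: L a_def powr_diff)
    have lnL: "ln (ln x) = ln t / \<theta>"
      using t0 by (simp add: L ln_powr)
    have Lp: "ln x powr (2 - 2 * \<theta>) = t powr (2 * a)"
      using assms by (simp add: L powr_powr a_def field_simps)
    have zz: "(t powr a)\<^sup>2 = t powr (2 * a)"
      using t0 by (simp add: power2_eq_square flip: powr_add)
    let ?D = "t powr (2 * a) / (768 * ln (1 + 16 * t))"
    let ?E = "1 / (2 * \<theta>) * (t powr (2 * a) / (ln t / \<theta>) powr (1 + 2 * \<delta>))"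
    \<comment> \<open>The factor 2 from the two bad events is paid for by the \<open>ln 2\<close> in
      the asymptotic bound.\<close>
    have step: "2 * exp (- d) \<le> exp (- e)" if "ln 2 + e \<le> d" for d e :: real
    proof -
      have "2 * exp (- d) = exp (ln 2 - d)" by (simp add: exp_diff exp_minus divide_inverse)
      also have "\<dots> \<le> exp (- e)" using that by simp
      finally show ?thesis .
    qed
    have "T \<le> t" using tT T' by linarith
    note le = step[OF T(2)[OF \<open>T \<le> t\<close>]]
    have "1 - 2 * exp (- (1 / t * ln x)\<^sup>2 / (768 * ln (1 + 16 / (1 / t))))
       \<le> prob {\<omega> \<in> space M. \<forall>y>x. partial_sum (\<lambda>n. f n \<omega>) (1 / 2 + 1 / t) y > 0}"
      using t0 x T(1)[of t] tT T' z by (intro prob_partial_sums_positive) auto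
    also have "1 / 2 + 1 / t = \<sigma>" using eps by simp
    finally show "1 - exp (- (1 / (2 * \<theta>) * ((ln x) powr (2 - 2 * \<theta>) / (ln (ln x)) powr (1 + 2 * \<delta>))))
      \<le> prob {\<omega> \<in> space M. \<forall>y>x. partial_sum (\<lambda>n. f n \<omega>) \<sigma> y > 0}"
      unfolding z power_divide zz Lp lnL using le by simp
  qed
qed

end
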